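(* Let $R$ be a semiring and $\mathbf E$ an algebra of type $\tau$. Then the semiring power $\mathbf E[R]$ is isomorphic to the Boolean power $\mathcal C(C(R)^*,\mathbf E)$, where $C(R)$ is the Boolean algebra of complemented and commuting elements of $R$.
   Context: A semiring is $(R,+,\cdot,0,1)$ with $(R,+,0)$ a commutative monoid, $(R,\cdot,1)$ a monoid (not necessarily commutative), $x0=0x=0$, two-sided distributivity. $r$ is complemented if some $s$ satisfies $r+s=1$, $rs=0$ (unique, written $r'$); commuting if $rt=tr$ for all $t$. $C(R)$ is the set of complemented commuting elements, a Boolean algebra under $r\vee s=r+r's$, $r\wedge s=rs$, $r\mapsto r'$, $0,1$. Let $\mathbf E$ have universe $E$. $V$ is the free left $R$-semimodule with basis $E$: finite-support formal sums $\mathbf v=\sum_{\mathsf d\in E}v_{\mathsf d}\mathsf d$, coordinatewise addition, $r\mathbf v=\sum(rv_{\mathsf d})\mathsf d$; $\mathsf d\in E$ is identified with the vector with coordinate $1$ at $\mathsf d$, $0$ elsewhere. For $k$-ary $g\in\tau$: $g^V(\mathbf v^1,\dots,\mathbf v^k)=\sum_{\mathsf d_1,\dots,\mathsf d_k}(v^1_{\mathsf d_1}\cdots v^k_{\mathsf d_k})g^{\mathbf E}(\mathsf d_1,\dots,\mathsf d_k)$. For finite nonempty $I=\{\mathsf e_1,\dots,\mathsf e_n\}\subseteq E$, $q_I(\mathbf v,\mathbf w^1,\dots,\mathbf w^n)=\sum_i v_{\mathsf e_i}\mathbf w^i$. $V_{\mathbf E}$ is the algebra on $V$ with the semimodule operations,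 all $g^V$, all $q_I$, and all $\mathsf e\in E$ as constants; $\theta(a,b)$ is its smallest congruence containing $(a,b)$. $\mathbf v$ is $I$-central if $\mathbf u\mapsto(\mathbf u/\theta(\mathbf v,\mathsf e_1),\dots,\mathbf u/\theta(\mathbf v,\mathsf e_n))$ is an isomorphism from $V_{\mathbf E}$ onto $\prod_iV_{\mathbf E}/\theta(\mathbf v,\mathsf e_i)$; finitely central if $I$-central for some finite nonempty $I$. $E[R]$ (the finitely central vectors) is closed under each $g^V$ and the semiring power is $\mathbf E[R]=(E[R],g^V|_{E[R]})_{g\in\tau}$. For a Boolean algebra $B$, $B^*$ is its Stone space, and $\mathcal C(B^*,\mathbf E)$ is the algebra of continuous maps $B^*\to E$ ($E$ discrete) with the operations of $\mathbf E$ defined pointwise. *)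

theory Defs
  imports "HOL-Library.Poly_Mapping" "HOL-Library.FuncSet" "HOL-Analysis.Abstract_Topology"
begin

section \<open>Universal algebra\<close>

text \<open>A type is a set of operation symbols together with an arity function. Operations take
  argument lists; only lists over the universe whose length is the arity of the symbol matter.\<close>

record ('f, 'a) alg =
  universe :: "'a set"
  opn :: "'f \<Rightarrow> 'a list \<Rightarrow> 'a"

definition args :: "'a set \<Rightarrow> nat \<Rightarrow> 'a list set" where
  "args A n = {xs. length xs = n \<and> set xs \<subseteq> A}"

definition is_alg :: "'f set \<Rightarrow> ('f \<Rightarrow> nat) \<Rightarrow> ('f, 'a) alg \<Rightarrow> bool" where
  "is_alg \<tau> ar A \<longleftrightarrow>
     universe A \<noteq> {} \<and> (\<forall>g\<in>\<tau>. \<forall>xs\<in>args (universe A) (ar g). opn A g xs \<in> universe A)"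

definition alg_iso ::
  "'f set \<Rightarrow> ('f \<Rightarrow> nat) \<Rightarrow> ('f, 'a) alg \<Rightarrow> ('f, 'b) alg \<Rightarrow> ('a \<Rightarrow> 'b) \<Rightarrow> bool" where
  "alg_iso \<tau> ar A B h \<longleftrightarrow>
     is_alg \<tau> ar A \<and> is_alg \<tau> ar B \<and> bij_betw h (universe A) (universe B) \<and>
     (\<forall>g\<in>\<tau>. \<forall>xs\<in>args (universe A) (ar g). h (opn A g xs) = opn B g (map h xs))"

definition isomorphic ::
  "'f set \<Rightarrow> ('f \<Rightarrow> nat) \<Rightarrow> ('f, 'a) alg \<Rightarrow> ('f, 'b) alg \<Rightarrow> bool" where
  "isomorphic \<tau> ar A B \<longleftrightarrow> (\<exists>h. alg_iso \<tau> ar A B h)"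

definition congruence :: "'f set \<Rightarrow> ('f \<Rightarrow> nat) \<Rightarrow> ('f, 'a) alg \<Rightarrow> ('a \<times> 'a) set \<Rightarrow> bool" where
  "congruence \<tau> ar A \<theta> \<longleftrightarrow>
     equiv (universe A) \<theta> \<and>
     (\<forall>g\<in>\<tau>. \<forall>xs\<in>args (universe A) (ar g). \<forall>ys\<in>args (universe A) (ar g).
        list_all2 (\<lambda>x y. (x, y) \<in> \<theta>) xs ys \<longrightarrow> (opn A g xs, opn A g ys) \<in> \<theta>)"

definition princ_cong ::
  "'f set \<Rightarrow> ('f \<Rightarrow> nat) \<Rightarrow> ('f, 'a) alg \<Rightarrow> 'a \<Rightarrow> 'a \<Rightarrow> ('a \<times> 'a) set" where
  "princ_cong \<tau> ar A a b = \<Inter> {\<theta>. congruence \<tau> ar A \<theta> \<and> (a, b) \<in> \<theta>}"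

definition quot_alg :: "('f, 'a) alg \<Rightarrow> ('a \<times> 'a) set \<Rightarrow> ('f, 'a set) alg" where
  "quot_alg A \<theta> =
     \<lparr>universe = universe A // \<theta>,
      opn = (\<lambda>g Xs. \<Union>xs\<in>listset Xs. \<theta> `` {opn A g xs})\<rparr>"

definition prod_alg :: "'i set \<Rightarrow> ('i \<Rightarrow> ('f, 'a) alg) \<Rightarrow> ('f, 'i \<Rightarrow> 'a) alg" where
  "prod_alg I A =
     \<lparr>universe = (\<Pi>\<^sub>E i\<in>I. universe (A i)),
      opn = (\<lambda>g xs. \<lambda>i\<in>I. opn (A i) g (map (\<lambda>x. x i) xs))\<rparr>"

lemma princ_cong_least:
  assumes "congruence \<tau> ar A \<theta>" "(a, b) \<in> \<theta>"
  shows "princ_cong \<tau> ar A a b \<subseteq> \<theta>"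
  using assms unfolding princ_cong_def by blast

lemma congruence_princ_cong:
  assumes A: "is_alg \<tau> ar A" and ab: "a \<in> universe A" "b \<in> universe A"
  shows "congruence \<tau> ar A (princ_cong \<tau> ar A a b)" "(a, b) \<in> princ_cong \<tau> ar A a b"
proof -
  have full: "congruence \<tau> ar A (universe A \<times> universe A)"
    using A unfolding congruence_def is_alg_def
    by (auto simp: equiv_def refl_on_def sym_def trans_def)
  then have sub: "princ_cong \<tau> ar A a b \<subseteq> universe A \<times> universe A"
    using ab by (intro princ_cong_least) auto
  have eq: "equiv (universe A) (princ_cong \<tau> ar A a b)"
  proof (rule equivI)
    show "refl_on (universe A) (princ_cong \<tau> ar A a b)"
      unfolding refl_on_def princ_cong_def by (auto simp: congruence_def equiv_def refl_on_def)
    show "sym (princ_cong \<tau> ar A a b)"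
      unfolding princ_cong_def sym_def by (auto simp: congruence_def equiv_def sym_def)
    show "trans (princ_cong \<tau> ar A a b)"
      unfolding princ_cong_def congruence_def equiv_def by (intro trans_INTER[of _ id, simplified]) auto
  qed (fact sub)
  show "congruence \<tau> ar A (princ_cong \<tau> ar A a b)"
    unfolding congruence_def
  proof (intro conjI ballI impI eq)
    fix g xs ys
    assume *: "g \<in> \<tau>" "xs \<in> args (universe A) (ar g)" "ys \<in> args (universe A) (ar g)"
      "list_all2 (\<lambda>x y. (x, y) \<in> princ_cong \<tau> ar A a b) xs ys"
    show "(opn A g xs, opn A g ys) \<in> princ_cong \<tau> ar A a b"
      unfolding princ_cong_def
    proof safe
      fix \<theta> assume \<theta>: "congruence \<tau> ar A \<theta>" "(a, b) \<in> \<theta>"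
      have "list_all2 (\<lambda>x y. (x, y) \<in> \<theta>) xs ys"
        by (rule list_all2_mono[OF *(4)]) (use princ_cong_least[OF \<theta>] in auto)
      then show "(opn A g xs, opn A g ys) \<in> \<theta>"
        using \<theta>(1) *(1-3) unfolding congruence_def by simp
    qed
  qed
  show "(a, b) \<in> princ_cong \<tau> ar A a b"
    unfolding princ_cong_def by blast
qed

section \<open>Boolean algebras, Stone spaces and Boolean powers\<close>

record 'a boolalg =
  bcarrier :: "'a set"
  bjoin :: "'a \<Rightarrow> 'a \<Rightarrow> 'a"
  bmeet :: "'a \<Rightarrow> 'a \<Rightarrow> 'a"
  bcompl :: "'a \<Rightarrow> 'a"
  bzero :: 'a
  bone :: 'a

text \<open>Huntington's axioms.\<close>

definition is_boolalg :: "'a boolalg \<Rightarrow> bool" where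
  "is_boolalg B \<longleftrightarrow>
     bzero B \<in> bcarrier B \<and> bone B \<in> bcarrier B \<and>
     (\<forall>x\<in>bcarrier B. bcompl B x \<in> bcarrier B \<and>
        bjoin B x (bzero B) = x \<and> bmeet B x (bone B) = x \<and>
        bjoin B x (bcompl B x) = bone B \<and> bmeet B x (bcompl B x) = bzero B) \<and>
     (\<forall>x\<in>bcarrier B. \<forall>y\<in>bcarrier B.
        bjoin B x y \<in> bcarrier B \<and> bmeet B x y \<in> bcarrier B \<and>
        bjoin B x y = bjoin B y x \<and> bmeet B x y = bmeet B y x) \<and>
     (\<forall>x\<in>bcarrier B. \<forall>y\<in>bcarrier B. \<forall>z\<in>bcarrier B.
        bjoin B x (bmeet B y z) = bmeet B (bjoin B x y) (bjoin B x z) \<and>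
        bmeet B x (bjoin B y z) = bjoin B (bmeet B x y) (bmeet B x z))"

definition ultrafilter :: "'a boolalg \<Rightarrow> 'a set \<Rightarrow> bool" where
  "ultrafilter B U \<longleftrightarrow>
     U \<subseteq> bcarrier B \<and> bone B \<in> U \<and> bzero B \<notin> U \<and>
     (\<forall>a\<in>U. \<forall>b\<in>U. bmeet B a b \<in> U) \<and>
     (\<forall>a\<in>U. \<forall>b\<in>bcarrier B. bmeet B a b = a \<longrightarrow> b \<in> U) \<and>
     (\<forall>b\<in>bcarrier B. b \<in> U \<or> bcompl B b \<in> U)"

definition stone_space :: "'a boolalg \<Rightarrow> 'a set topology" where
  "stone_space B =
     topology_generated_by ((\<lambda>b. {U. ultrafilter B U \<and> b \<in> U}) ` bcarrier B)"

lemma topspace_stone_space: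
  assumes "is_boolalg B"
  shows "topspace (stone_space B) = {U. ultrafilter B U}"
proof -
  have "bone B \<in> bcarrier B" using assms by (simp add: is_boolalg_def)
  moreover have "bone B \<in> U" if "ultrafilter B U" for U using that by (simp add: ultrafilter_def)
  ultimately show ?thesis unfolding stone_space_def topology_generated_by_topspace by blast
qed

text \<open>Continuous maps are taken extensional, i.e. \<^const>\<open>undefined\<close> outside the space,
  so that maps agreeing on the space are equal.\<close>

definition cont_alg :: "'x topology \<Rightarrow> ('f, 'e) alg \<Rightarrow> ('f, 'x \<Rightarrow> 'e) alg" where
  "cont_alg X E =
     \<lparr>universe = {f \<in> extensional (topspace X). continuous_map X (discrete_topology (universe E)) f},
      opn = (\<lambda>g fs. \<lambda>x\<in>topspace X. opn E g (map (\<lambda>f. f x) fs))\<rparr>"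

definition boolean_power :: "'a boolalg \<Rightarrow> ('f, 'e) alg \<Rightarrow> ('f, 'a set \<Rightarrow> 'e) alg" where
  "boolean_power B E = cont_alg (stone_space B) E"

section \<open>Complemented commuting elements of a semiring\<close>

text \<open>The sort \<open>{semiring_0, monoid_mult}\<close> describes unital semirings;
  unlike \<^class>\<open>semiring_1\<close> it does not demand \<open>0 \<noteq> 1\<close>.\<close>

definition complemented :: "'r::{semiring_0, monoid_mult} \<Rightarrow> bool" where
  "complemented r \<longleftrightarrow> (\<exists>s. r + s = 1 \<and> r * s = 0)"

definition commuting :: "'r::{semiring_0, monoid_mult} \<Rightarrow> bool" where
  "commuting r \<longleftrightarrow> (\<forall>t. r * t = t * r)"

definition compl_of :: "'r::{semiring_0, monoid_mult} \<Rightarrow> 'r" where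
  "compl_of r = (THE s. r + s = 1 \<and> r * s = 0)"

definition centre_balg :: "'r::{semiring_0, monoid_mult} boolalg" where
  "centre_balg =
     \<lparr>bcarrier = {r. complemented r \<and> commuting r},
      bjoin = (\<lambda>r s. r + compl_of r * s),
      bmeet = (*),
      bcompl = compl_of,
      bzero = 0,
      bone = 1\<rparr>"

lemma compl_of_eq:
  fixes r s :: "'r::{semiring_0, monoid_mult}"
  assumes r: "commuting r" and s: "r + s = 1" "r * s = 0"
  shows "compl_of r = s"
  unfolding compl_of_def
proof (rule the_equality)
  fix t assume t: "r + t = 1 \<and> r * t = 0"
  have "t = (r + s) * t" using s by simp
  also have "\<dots> = s * t" using t by (simp add: distrib_right)
  also have "\<dots> = s * r + s * t" using r s by (metis commuting_def add_0)
  also have "\<dots> = s * (r + t)" by (simp add: distrib_left)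
  finally show "t = s" using t by simp
qed (use s in simp)

lemma compl_of:
  fixes r :: "'r::{semiring_0, monoid_mult}"
  assumes "complemented r" "commuting r"
  shows "r + compl_of r = 1" "r * compl_of r = 0" "commuting (compl_of r)"
    "complemented (compl_of r)"
proof -
  obtain s where s: "r + s = 1" "r * s = 0" using assms by (auto simp: complemented_def)
  have rc: "r * t = t * r" for t using assms by (simp add: commuting_def)
  have eq: "compl_of r = s" by (rule compl_of_eq) (use assms s in auto)
  have "s * t = t * s" for t
  proof -
    have "s * t = s * t * (r + s)" using s by simp
    also have "\<dots> = s * t * r + s * t * s" by (simp add: distrib_left)
    also have "s * t * r = r * s * t" using rc[of "s * t"] by (simp add: mult.assoc)
    also have "r * s * t + s * t * s = s * t * s" using s by simp
    finally have 1: "s * t = s * t * s" .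
    have "t * s = (r + s) * (t * s)" using s by simp
    also have "\<dots> = r * t * s + s * t * s" by (simp add: distrib_right mult.assoc)
    also have "r * t * s = t * (r * s)" using rc[of t] by (simp add: mult.assoc)
    also have "t * (r * s) + s * t * s = s * t * s" using s by simp
    finally show ?thesis using 1 by simp
  qed
  then show "commuting (compl_of r)" by (simp add: eq commuting_def)
  show "r + compl_of r = 1" "r * compl_of r = 0" using s by (simp_all add: eq)
  have "s + r = 1" "s * r = 0" using s rc[of s] by (simp_all add: add.commute)
  then show "complemented (compl_of r)" unfolding eq complemented_def by blast
qed

lemma is_boolalg_centre: "is_boolalg (centre_balg :: 'r::{semiring_0, monoid_mult} boolalg)"
proof -
  let ?C = "{r :: 'r. complemented r \<and> commuting r}"
  have comm: "x * y = y * x" if "x \<in> ?C" for x y using that by (simp add: commuting_def)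
  have cl: "compl_of x \<in> ?C" "x + compl_of x = 1" "x * compl_of x = 0" "compl_of x * x = 0"
    if "x \<in> ?C" for x
    using that compl_of[of x] comm[OF that, of "compl_of x"] by auto
  have idem: "x * x = x" if "x \<in> ?C" for x
    using cl(2,3)[OF that] by (metis add.right_neutral distrib_left mult_1_right)
  have prodC: "commuting (x * y)" if "x \<in> ?C" "y \<in> ?C" for x y
    unfolding commuting_def
  proof
    fix t
    have "x * y * t = x * t * y" using comm[OF that(2), of t] by (simp add: mult.assoc)
    also have "\<dots> = t * (x * y)" using comm[OF that(1), of t] by (simp add: mult.assoc)
    finally show "x * y * t = t * (x * y)" .
  qed
  have join: "x + compl_of x * y \<in> ?C" "compl_of (x + compl_of x * y) = compl_of x * compl_of y"
    if x: "x \<in> ?C" and y: "y \<in> ?C" for x y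
  proof -
    let ?j = "x + compl_of x * y" and ?k = "compl_of x * compl_of y"
    have 1: "?j + ?k = 1"
      using cl(2)[OF x] cl(2)[OF y] by (metis add.assoc distrib_left mult_1_right)
    have "compl_of x * y * ?k = compl_of x * (y * compl_of x) * compl_of y"
      by (simp add: mult.assoc)
    also have "\<dots> = compl_of x * compl_of x * (y * compl_of y)"
      unfolding comm[OF y, of "compl_of x"] by (simp add: mult.assoc)
    finally have "compl_of x * y * ?k = 0" using cl(3)[OF y] by simp
    moreover have "x * ?k = 0" using cl(3)[OF x] by (metis mult.assoc mult_zero_left)
    ultimately have 2: "?j * ?k = 0" by (simp add: distrib_right)
    have 3: "commuting ?j"
      using prodC[OF cl(1)[OF x] y] comm[OF x] unfolding commuting_def
      by (metis distrib_left distrib_right)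
    show "?j \<in> ?C" using 1 2 3 by (auto simp: complemented_def)
    show "compl_of ?j = ?k" by (rule compl_of_eq[OF 3 1 2])
  qed
  have joinc: "x + compl_of x * y = x * y + x * compl_of y + compl_of x * y"
    if y: "y \<in> ?C" for x y
    using cl(2)[OF y] by (metis distrib_left mult_1_right)
  have joincomm: "x + compl_of x * y = y + compl_of y * x" if x: "x \<in> ?C" and y: "y \<in> ?C" for x y
    unfolding joinc[OF y] joinc[OF x]
    unfolding comm[OF x, of y] comm[OF x, of "compl_of y"] comm[OF y, of "compl_of x"]
    by (simp only: ac_simps)
  have meet: "x * y \<in> ?C" "compl_of (x * y) = compl_of x + x * compl_of y"
    if x: "x \<in> ?C" and y: "y \<in> ?C" for x y
  proof -
    let ?k = "compl_of x + x * compl_of y"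
    have "x * y + ?k = x * (y + compl_of y) + compl_of x"
      unfolding distrib_left by (simp only: ac_simps)
    then have 1: "x * y + ?k = 1" using cl(2)[OF x] cl(2)[OF y] by simp
    have 2: "x * y * ?k = 0"
    proof -
      have "x * y * compl_of x = y * (x * compl_of x)"
        using comm[OF x, of y] by (simp add: mult.assoc)
      moreover have "x * y * (x * compl_of y) = x * x * (y * compl_of y)"
        using comm[OF x, of y] by (metis mult.assoc)
      ultimately show ?thesis using cl(3)[OF x] cl(3)[OF y] by (simp add: distrib_left)
    qed
    show "x * y \<in> ?C" using 1 2 prodC[OF x y] by (auto simp: complemented_def)
    show "compl_of (x * y) = ?k" by (rule compl_of_eq[OF prodC[OF x y] 1 2])
  qed
  have one: "compl_of (1::'r) = 0" and zero: "compl_of (0::'r) = 1"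
    by (rule compl_of_eq; simp add: commuting_def)+
  have dist1: "x * (y + compl_of y * z) = x * y + compl_of (x * y) * (x * z)"
    if x: "x \<in> ?C" and y: "y \<in> ?C" and z: "z \<in> ?C" for x y z
  proof -
    have "compl_of (x * y) * (x * z) = compl_of x * x * z + x * compl_of y * x * z"
      by (simp add: meet(2)[OF x y] distrib_right mult.assoc)
    also have "\<dots> = x * compl_of y * x * z" using cl(4)[OF x] by simp
    also have "\<dots> = x * x * compl_of y * z" using comm[OF x, of "compl_of y"] by (metis mult.assoc)
    finally show ?thesis using idem[OF x] by (simp add: distrib_left mult.assoc)
  qed
  have dist2: "x + compl_of x * (y * z) = (x + compl_of x * y) * (x + compl_of x * z)"
    if x: "x \<in> ?C" and y: "y \<in> ?C" and z: "z \<in> ?C" for x y z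
  proof -
    have "(x + compl_of x * y) * (x + compl_of x * z)
        = x * x + (x * compl_of x) * z + compl_of x * y * x + compl_of x * y * (compl_of x * z)"
      by (simp add: distrib_left distrib_right mult.assoc add.assoc add.left_commute)
    moreover have "compl_of x * y * x = 0" 
      using comm[OF y, of x] cl(4)[OF x] by (metis mult.assoc mult_zero_left)
    moreover have "compl_of x * y * (compl_of x * z) = compl_of x * (y * z)"
      using comm[OF y, of "compl_of x"] idem[OF cl(1)[OF x]] by (metis mult.assoc)
    ultimately show ?thesis using idem[OF x] cl(3)[OF x] by simp
  qed
  have C01: "0 \<in> ?C" "1 \<in> ?C" by (auto simp: complemented_def commuting_def)
  have cjoin: "x + compl_of x * compl_of x = 1" if "x \<in> ?C" for x
    using idem[OF cl(1)[OF that]] cl(2)[OF that] by simp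
  show ?thesis
    unfolding is_boolalg_def centre_balg_def boolalg.simps
    by (intro conjI ballI C01 cl(1) cl(3) cjoin join(1) meet(1) joincomm comm dist1 dist2;
        (assumption | simp only: mult_zero_right mult_1_right add_0_right))
qed

section \<open>The algebra of vectors and semiring powers\<close>

text \<open>The free left semimodule on the universe of \<open>E\<close> consists of the finitely supported
  functions whose support lies in that universe.\<close>

definition vecs :: "'e set \<Rightarrow> ('e \<Rightarrow>\<^sub>0 'r::{semiring_0, monoid_mult}) set" where
  "vecs E = {v. Poly_Mapping.keys v \<subseteq> E}"

definition bvec :: "'e \<Rightarrow> ('e \<Rightarrow>\<^sub>0 'r::{semiring_0, monoid_mult})" where
  "bvec d = Poly_Mapping.single d 1"

definition scale ::
  "'r::{semiring_0, monoid_mult} \<Rightarrow> ('e \<Rightarrow>\<^sub>0 'r) \<Rightarrow> ('e \<Rightarrow>\<^sub>0 'r)" where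
  "scale r v = Poly_Mapping.map ((*) r) v"

text \<open>Summands with some \<open>d\<^sub>i\<close> outside the support of the \<open>i\<close>-th vector vanish, hence the
  restriction of the sum to a finite product of supports.\<close>

definition vec_op ::
  "('f, 'e) alg \<Rightarrow> 'f \<Rightarrow> ('e \<Rightarrow>\<^sub>0 'r::{semiring_0, monoid_mult}) list \<Rightarrow> ('e \<Rightarrow>\<^sub>0 'r)" where
  "vec_op E g vs =
     (\<Sum>ds\<in>listset (map Poly_Mapping.keys vs).
        scale (prod_list (map2 Poly_Mapping.lookup vs ds)) (bvec (opn E g ds)))"

definition q_op ::
  "'e list \<Rightarrow> ('e \<Rightarrow>\<^sub>0 'r::{semiring_0, monoid_mult}) \<Rightarrow> ('e \<Rightarrow>\<^sub>0 'r) list \<Rightarrow> ('e \<Rightarrow>\<^sub>0 'r)" where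
  "q_op es v ws = (\<Sum>i<length es. scale (Poly_Mapping.lookup v (es ! i)) (ws ! i))"

text \<open>The operation \<open>q\<^sub>I\<close> depends on the enumeration of \<open>I\<close>, so its symbol carries
  a list without repetitions; different enumerations of the same set only permute arguments.\<close>

datatype ('f, 'e, 'r) vsym =
  VZero | VAdd | VScale 'r | VOp 'f | VQ "'e list" | VConst 'e

definition vsyms :: "'f set \<Rightarrow> 'e set \<Rightarrow> ('f, 'e, 'r) vsym set" where
  "vsyms \<tau> E =
     {VZero, VAdd} \<union> range VScale \<union> VOp ` \<tau>
     \<union> VQ ` {es. es \<noteq> [] \<and> distinct es \<and> set es \<subseteq> E} \<union> VConst ` E"

fun varity :: "('f \<Rightarrow> nat) \<Rightarrow> ('f, 'e, 'r) vsym \<Rightarrow> nat" where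
  "varity ar VZero = 0"
| "varity ar VAdd = 2"
| "varity ar (VScale r) = 1"
| "varity ar (VOp g) = ar g"
| "varity ar (VQ es) = Suc (length es)"
| "varity ar (VConst e) = 0"

fun vopn ::
  "('f, 'e) alg \<Rightarrow> ('f, 'e, 'r) vsym \<Rightarrow>
     ('e \<Rightarrow>\<^sub>0 'r::{semiring_0, monoid_mult}) list \<Rightarrow> ('e \<Rightarrow>\<^sub>0 'r)" where
  "vopn E VZero vs = 0"
| "vopn E VAdd vs = vs ! 0 + vs ! 1"
| "vopn E (VScale r) vs = scale r (vs ! 0)"
| "vopn E (VOp g) vs = vec_op E g vs"
| "vopn E (VQ es) vs = q_op es (hd vs) (tl vs)"
| "vopn E (VConst e) vs = bvec e"

definition vec_alg ::
  "('f, 'e) alg \<Rightarrow> (('f, 'e, 'r) vsym, 'e \<Rightarrow>\<^sub>0 'r::{semiring_0, monoid_mult}) alg" where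
  "vec_alg E = \<lparr>universe = vecs (universe E), opn = vopn E\<rparr>"

definition vtheta ::
  "'f set \<Rightarrow> ('f \<Rightarrow> nat) \<Rightarrow> ('f, 'e) alg \<Rightarrow> ('e \<Rightarrow>\<^sub>0 'r::{semiring_0, monoid_mult}) \<Rightarrow>
     ('e \<Rightarrow>\<^sub>0 'r) \<Rightarrow> (('e \<Rightarrow>\<^sub>0 'r) \<times> ('e \<Rightarrow>\<^sub>0 'r)) set" where
  "vtheta \<tau> ar E a b = princ_cong (vsyms \<tau> (universe E)) (varity ar) (vec_alg E) a b"

definition I_central ::
  "'f set \<Rightarrow> ('f \<Rightarrow> nat) \<Rightarrow> ('f, 'e) alg \<Rightarrow> 'e set \<Rightarrow>
     ('e \<Rightarrow>\<^sub>0 'r::{semiring_0, monoid_mult}) \<Rightarrow> bool" where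
  "I_central \<tau> ar E I v \<longleftrightarrow>
     alg_iso (vsyms \<tau> (universe E)) (varity ar)
       (vec_alg E)
       (prod_alg I (\<lambda>e. quot_alg (vec_alg E) (vtheta \<tau> ar E v (bvec e))))
       (\<lambda>u. \<lambda>e\<in>I. vtheta \<tau> ar E v (bvec e) `` {u})"

definition finitely_central ::
  "'f set \<Rightarrow> ('f \<Rightarrow> nat) \<Rightarrow> ('f, 'e) alg \<Rightarrow> ('e \<Rightarrow>\<^sub>0 'r::{semiring_0, monoid_mult}) \<Rightarrow> bool" where
  "finitely_central \<tau> ar E v \<longleftrightarrow>
     (\<exists>I. finite I \<and> I \<noteq> {} \<and> I \<subseteq> universe E \<and> I_central \<tau> ar E I v)"

definition semiring_power ::
  "'f set \<Rightarrow> ('f \<Rightarrow> nat) \<Rightarrow> ('f, 'e) alg \<Rightarrow> ('f, 'e \<Rightarrow>\<^sub>0 'r::{semiring_0, monoid_mult}) alg" where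
  "semiring_power \<tau> ar E =
     \<lparr>universe = {v \<in> vecs (universe E). finitely_central \<tau> ar E v}, opn = vec_op E\<rparr>"

lemma keys_scale: "Poly_Mapping.keys (scale r v) \<subseteq> Poly_Mapping.keys v"
  unfolding scale_def by (auto simp: in_keys_iff map.rep_eq when_def)

lemma vecs_sum: "(\<And>i. i \<in> A \<Longrightarrow> f i \<in> vecs E) \<Longrightarrow> sum f A \<in> vecs E"
  using keys_sum[of f A] unfolding vecs_def by blast

lemma vecs_scale: "v \<in> vecs E \<Longrightarrow> scale r v \<in> vecs E"
  using keys_scale[of r v] unfolding vecs_def by blast

lemma vecs_bvec: "e \<in> E \<Longrightarrow> bvec e \<in> vecs E"
  unfolding vecs_def bvec_def by simp

lemma listset_conv_list_all2: "listset As = {xs. list_all2 (\<in>) xs As}"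
  by (induction As) (auto simp: set_Cons_def list_all2_Cons2)

lemma is_alg_vec_alg:
  fixes E :: "('f, 'e) alg"
  assumes E: "is_alg \<tau> ar E"
  shows "is_alg (vsyms \<tau> (universe E)) (varity ar)
    (vec_alg E :: (('f, 'e, 'r) vsym, 'e \<Rightarrow>\<^sub>0 'r::{semiring_0, monoid_mult}) alg)"
  unfolding is_alg_def
proof (intro conjI ballI)
  let ?V = "vec_alg E :: (('f, 'e, 'r) vsym, 'e \<Rightarrow>\<^sub>0 'r) alg"
  have zero: "(0 :: 'e \<Rightarrow>\<^sub>0 'r) \<in> vecs (universe E)" by (simp add: vecs_def)
  then show "universe ?V \<noteq> {}" by (auto simp: vec_alg_def)
  fix s :: "('f, 'e, 'r) vsym" and vs :: "('e \<Rightarrow>\<^sub>0 'r) list"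
  assume s: "s \<in> vsyms \<tau> (universe E)" and vs: "vs \<in> args (universe ?V) (varity ar s)"
  then have len: "length vs = varity ar s" and mem: "\<And>i. i < varity ar s \<Longrightarrow> vs ! i \<in> vecs (universe E)"
    by (auto simp: args_def vec_alg_def)
  have "vopn E s vs \<in> vecs (universe E)"
  proof (cases s)
    case VAdd
    then show ?thesis using mem[of 0] mem[of 1] Poly_Mapping.keys_add[of "vs ! 0" "vs ! 1"]
      by (auto simp: vecs_def)
  next
    case (VOp g)
    have "opn E g ds \<in> universe E" if "ds \<in> listset (map Poly_Mapping.keys vs)" for ds
    proof -
      have "ds \<in> args (universe E) (ar g)"
        using that len mem VOp unfolding listset_conv_list_all2
        by (fastforce simp: args_def list_all2_conv_all_nth vecs_def in_set_conv_nth)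
      then show ?thesis using E s VOp by (auto simp: is_alg_def vsyms_def)
    qed
    then show ?thesis using VOp
      by (auto simp: vec_op_def intro!: vecs_sum vecs_scale vecs_bvec)
  next
    case (VQ es)
    then have "tl vs ! i \<in> vecs (universe E)" if "i < length es" for i
      using that mem[of "Suc i"] len by (cases vs) auto
    then show ?thesis using VQ by (auto simp: q_op_def intro!: vecs_sum vecs_scale)
  qed (use s zero mem[of 0] in \<open>auto simp: vsyms_def intro!: vecs_scale vecs_bvec\<close>)
  then show "opn ?V s vs \<in> universe ?V" by (simp add: vec_alg_def)
qed

end

theory Submission
  imports Defs
begin

text \<open>Let \<open>v\<close> be \<open>I\<close>-central. Modulo \<open>\<theta>(v, e)\<close> the vector \<open>v\<close> acts in \<open>q\<^sub>I\<close> as the projection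
  onto the argument indexed by \<open>e\<close>, hence \<open>q\<^sub>I(v, w)\<close> is the only vector congruent to \<open>w\<^sub>e\<close>
  modulo \<open>\<theta>(v, e)\<close> for every \<open>e \<in> I\<close>. Evaluating this uniqueness on suitable tuples \<open>w\<close> shows
  that the coordinates of \<open>v\<close> are commuting, pairwise orthogonal and sum to \<open>1\<close>. Conversely, for
  such a \<open>v\<close> the congruence \<open>\<theta>(v, e)\<close> is contained in the kernel of \<open>u \<mapsto> v\<^sub>e u\<close>, and these kernels
  intersect trivially because \<open>\<Sum>\<^sub>e v\<^sub>e = 1\<close>. So the finitely central vectors are the finite
  partitions of unity in \<open>C(R)\<close> indexed by elements of \<open>E\<close>. By the ultrafilter theorem these are
  the vectors with coordinates in \<open>C(R)\<close> exactly one of which lies in any given ultrafilter;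
  the isomorphism sends \<open>v\<close> to the map picking the index of that coordinate, and it is
  onto because the Stone space is compact.\<close>

section \<open>Boolean algebra laws in the centre\<close>

section \<open>Complemented commuting elements\<close>

text \<open>Same set as \<open>bcarrier centre_balg\<close>, named separately so that computations
  stay in the semiring and avoid the record.\<close>

definition centre :: "'r::{semiring_0, monoid_mult} set" where
  "centre = {r. complemented r \<and> commuting r}"

abbreviation join :: "'r::{semiring_0, monoid_mult} \<Rightarrow> 'r \<Rightarrow> 'r" where
  "join r s \<equiv> r + compl_of r * s"

lemma centre_comm: "x \<in> centre \<Longrightarrow> x * y = y * x"
  by (simp add: centre_def commuting_def)

lemma centre_compl:
  assumes "x \<in> centre"
  shows "compl_of x \<in> centre" "x + compl_of x = 1" "x * compl_of x = 0" "compl_of x * x = 0"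
  using assms compl_of[of x] centre_comm[OF assms, of "compl_of x"] by (auto simp: centre_def)

lemma centre_idem: "x \<in> centre \<Longrightarrow> x * x = x"
  using centre_compl(2,3)[of x] by (metis add.right_neutral distrib_left mult_1_right)

lemma centre_closed:
  fixes x y :: "'r::{semiring_0, monoid_mult}"
  shows "(0::'r) \<in> centre" "(1::'r) \<in> centre"
    and "x \<in> centre \<Longrightarrow> y \<in> centre \<Longrightarrow> x * y \<in> centre"
    and "x \<in> centre \<Longrightarrow> y \<in> centre \<Longrightarrow> join x y \<in> centre"
  using is_boolalg_centre[where 'r='r]
  unfolding is_boolalg_def centre_balg_def centre_def boolalg.simps by blast+

lemma compl_of_compl_of:
  assumes "x \<in> centre" shows "compl_of (compl_of x) = x"
  by (rule compl_of_eq) (use assms centre_compl[OF assms] in \<open>auto simp: centre_def add.commute\<close>)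

lemma compl_of_zero_one:
  "compl_of (0::'r::{semiring_0, monoid_mult}) = 1" "compl_of (1::'r) = 0"
  by (rule compl_of_eq; simp add: commuting_def)+

text \<open>De Morgan's law. As \<open>compl_of (compl_of x) = x\<close>, the right side unfolds to
  x' + x y', which is checked directly to be a complement of x y; uniqueness of complements does the
  rest.\<close>

lemma compl_of_mult:
  assumes x: "x \<in> centre" and y: "y \<in> centre"
  shows "compl_of (x * y) = join (compl_of x) (compl_of y)"
proof (rule compl_of_eq)
  show "commuting (x * y)" using centre_closed(3)[OF x y] by (simp add: centre_def)
  have "x * y + (compl_of x + x * compl_of y) = x * (y + compl_of y) + compl_of x"
    unfolding distrib_left by (simp only: ac_simps)
  then show "x * y + join (compl_of x) (compl_of y) = 1"
    using centre_compl[OF x] centre_compl[OF y] by (simp add: compl_of_compl_of x)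
  have "x * y * compl_of x = y * (x * compl_of x)"
    using centre_comm[OF x, of y] by (simp add: mult.assoc)
  moreover have "x * y * (x * compl_of y) = x * x * (y * compl_of y)"
    using centre_comm[OF x, of y] by (metis mult.assoc)
  ultimately show "x * y * join (compl_of x) (compl_of y) = 0"
    using centre_compl[OF x] centre_compl[OF y] by (simp add: compl_of_compl_of x distrib_left)
qed

text \<open>Multiplying \<open>x + compl_of x = 1\<close> by \<open>y\<close> leaves y = x' y,
  because x y vanishes. Sums of orthogonal central elements can thus be read as Boolean
  joins.\<close>

lemma join_orthogonal:
  assumes "x \<in> centre" and "x * y = 0" shows "join x y = x + y"
proof -
  have "y = (x + compl_of x) * y" using centre_compl(2)[OF assms(1)] by simp
  then show ?thesis using assms(2) by (simp add: distrib_right)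
qed

section \<open>The ultrafilter theorem and compactness of the Stone space\<close>

section \<open>Ultrafilters of the centre\<close>

abbreviation point :: "'r::{semiring_0, monoid_mult} set \<Rightarrow> bool" where
  "point \<equiv> ultrafilter centre_balg"

lemma point_iff:
  "point U \<longleftrightarrow> U \<subseteq> centre \<and> 1 \<in> U \<and> 0 \<notin> U \<and> (\<forall>a\<in>U. \<forall>b\<in>U. a * b \<in> U) \<and>
     (\<forall>a\<in>U. \<forall>b\<in>centre. a * b = a \<longrightarrow> b \<in> U) \<and> (\<forall>b\<in>centre. b \<in> U \<or> compl_of b \<in> U)"
  by (simp add: ultrafilter_def centre_balg_def centre_def)

lemma point_compl:
  assumes "point U" "x \<in> centre" shows "compl_of x \<in> U \<longleftrightarrow> x \<notin> U"
  using assms centre_compl(3)[OF assms(2)] unfolding point_iff by metis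

lemma point_mult:
  assumes U: "point U" and x: "x \<in> centre" and y: "y \<in> centre"
  shows "x * y \<in> U \<longleftrightarrow> x \<in> U \<and> y \<in> U"
proof -
  \<comment> \<open>Upward closure is phrased through the order in which a lies below b iff a b = a;
    these equations put \<open>x * y\<close> below both factors.\<close>
  have "x * y * y = x * y" "x * y * x = x * y"
    using centre_idem[OF x] centre_idem[OF y] centre_comm[OF x, of y] by (metis mult.assoc)+
  then show ?thesis using U x y unfolding point_iff by blast
qed

lemma point_join:
  assumes U: "point U" and x: "x \<in> centre" and y: "y \<in> centre"
  shows "join x y \<in> U \<longleftrightarrow> x \<in> U \<or> y \<in> U"
proof -
  have "compl_of x * compl_of y \<in> U \<longleftrightarrow> x \<notin> U \<and> y \<notin> U"
    using point_mult[OF U] point_compl[OF U] centre_compl(1) x y by blast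
  moreover have "join x y = compl_of (compl_of x * compl_of y)"
    using compl_of_mult[OF centre_compl(1)[OF x] centre_compl(1)[OF y]]
    by (simp add: compl_of_compl_of x y)
  ultimately show ?thesis
    using point_compl[OF U centre_closed(3)[OF centre_compl(1)[OF x] centre_compl(1)[OF y]]] by simp
qed

text \<open>Zorn's lemma is applied to the multiplicatively closed subsets of the centre that
  contain F and omit 0. Upward closure is not imposed on them: it follows for a maximal M, since
  every central element outside M is annihilated by an element of M.\<close>

lemma ex_point_superset:
  fixes F :: "'r::{semiring_0, monoid_mult} set"
  assumes F: "F \<subseteq> centre" "1 \<in> F" "0 \<notin> F" "\<And>a b. a \<in> F \<Longrightarrow> b \<in> F \<Longrightarrow> a * b \<in> F"
  obtains U where "point U" "F \<subseteq> U"
proof -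
  define A where "A = {G. F \<subseteq> G \<and> G \<subseteq> centre \<and> 0 \<notin> G \<and> (\<forall>a\<in>G. \<forall>b\<in>G. a * b \<in> G)}"
  have "\<Union>\<C> \<in> A" if ne: "\<C> \<noteq> {}" and ch: "subset.chain A \<C>" for \<C>
  proof -
    have sub: "\<C> \<subseteq> A" and tot: "\<And>X Y. X \<in> \<C> \<Longrightarrow> Y \<in> \<C> \<Longrightarrow> X \<subseteq> Y \<or> Y \<subseteq> X"
      using ch by (auto simp: subset.chain_def)
    have "a * b \<in> \<Union>\<C>" if ab: "a \<in> X" "X \<in> \<C>" "b \<in> Y" "Y \<in> \<C>" for a b X Y
    proof -
      obtain Z where Z: "Z \<in> \<C>" "a \<in> Z" "b \<in> Z" using tot[of X Y] ab by blast
      then have "Z \<in> A" using sub by blast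
      then have "a * b \<in> Z" using Z by (simp add: A_def)
      then show ?thesis using Z(1) by blast
    qed
    then show ?thesis using sub ne unfolding A_def by blast
  qed
  moreover have "F \<in> A" using F by (auto simp: A_def)
  ultimately obtain M where M: "M \<in> A" and max: "\<And>X. X \<in> A \<Longrightarrow> M \<subseteq> X \<Longrightarrow> X = M"
    using subset_Zorn_nonempty[of A] by blast
  have MC: "M \<subseteq> centre" and M0: "0 \<notin> M" and M1: "1 \<in> M"
    and Mm: "\<And>a b. a \<in> M \<Longrightarrow> b \<in> M \<Longrightarrow> a * b \<in> M"
    using M F(2) by (auto simp: A_def)
  \<comment> \<open>Otherwise M together with M b would be a larger member of \<open>A\<close>; it
    contains b because 1 is in M.\<close>
  have kill: "\<exists>x\<in>M. x * b = 0" if b: "b \<in> centre" "b \<notin> M" for b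
  proof (rule ccontr)
    assume no: "\<not> ?thesis"
    let ?N = "M \<union> (\<lambda>x. x * b) ` M"
    have 1: "x * b * y = x * y * b" for x y
      using centre_comm[OF b(1), of y] by (simp add: mult.assoc)
    have 2: "x * b * (y * b) = x * y * b" for x y
      unfolding 1[of x "y * b"] using centre_idem[OF b(1)] by (simp add: mult.assoc)
    have "p * q \<in> ?N" if pq: "p \<in> ?N" "q \<in> ?N" for p q
    proof -
      obtain x y where "x \<in> M" "y \<in> M" and c: "p = x \<or> p = x * b" "q = y \<or> q = y * b"
        using pq by blast
      then have "x * y \<in> M" using Mm by blast
      moreover have "p * q = x * y \<or> p * q = x * y * b"
        using c 1[of x y] 2[of x y] mult.assoc[of x y b] by auto
      ultimately show ?thesis by auto
    qed
    moreover have "?N \<subseteq> centre" using MC b(1) by (auto intro: centre_closed(3))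
    moreover have "F \<subseteq> ?N" "0 \<notin> ?N" using M M0 no by (auto simp: A_def)
    ultimately have "?N \<in> A" unfolding A_def by blast
    then have "?N = M" using max by blast
    moreover have "b \<in> ?N" using M1 by force
    ultimately show False using b(2) by simp
  qed
  have "point M"
    unfolding point_iff
  proof (intro conjI ballI impI)
    fix a b assume a: "a \<in> M" and b: "b \<in> centre" and ab: "a * b = a"
    show "b \<in> M"
    proof (rule ccontr)
      assume "b \<notin> M"
      then obtain x where x: "x \<in> M" "x * b = 0" using kill b by blast
      \<comment> \<open>From a = a b, the product x a of two elements of M equals x b a = 0.\<close>
      have "x * a = x * b * a" using ab centre_comm[OF b, of a] by (metis mult.assoc)
      then show False using x Mm[OF x(1) a] M0 by simp
    qed
  next
    fix b :: 'r assume b: "b \<in> centre"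
    show "b \<in> M \<or> compl_of b \<in> M"
    proof (rule ccontr)
      assume "\<not> ?thesis"
      then obtain x y where x: "x \<in> M" "x * b = 0" and y: "y \<in> M" "y * compl_of b = 0"
        using kill[OF b] kill[OF centre_compl(1)[OF b]] by blast
      \<comment> \<open>Splitting x y along b + b' = 1 gives one summand killed by x b = 0 and one
        killed by y b' = 0, so 0 would lie in M.\<close>
      have "x * y = x * y * (b + compl_of b)" using centre_compl(2)[OF b] by simp
      also have "\<dots> = x * b * y + x * (y * compl_of b)"
        using centre_comm[OF b, of y] by (simp add: distrib_left mult.assoc)
      finally show False using x y Mm[OF x(1) y(1)] M0 by simp
    qed
  qed (use MC M0 M1 Mm in auto)
  then show thesis using that M by (auto simp: A_def)
qed

text \<open>For nonzero a the set {1, a} is multiplicatively closed by idempotence and omits 0,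
  since 1 = 0 would force a = 0; so it extends to an ultrafilter.\<close>

lemma point_separates_zero:
  assumes a: "a \<in> centre" and no: "\<And>U. point U \<Longrightarrow> a \<notin> U"
  shows "a = 0"
proof (rule ccontr)
  assume "a \<noteq> 0"
  moreover from this have "(1::'a) \<noteq> 0" by (metis mult_1_right mult_zero_right)
  ultimately obtain U where "point U" "{1, a} \<subseteq> U"
    using a centre_idem[OF a] centre_closed(2) by (auto intro: ex_point_superset[of "{1, a}"])
  then show False using no by auto
qed

text \<open>Injectivity of the Stone representation: a b' lies in no ultrafilter, so it vanishes and
  a = a b; exchanging the roles gives equality. Identities in the centre can thus be tested one
  ultrafilter at a time.\<close>

lemma centre_eqI:
  assumes a: "a \<in> centre" and b: "b \<in> centre" and eq: "\<And>U. point U \<Longrightarrow> a \<in> U \<longleftrightarrow> b \<in> U"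
  shows "a = b"
proof -
  have *: "x = x * y"
    if x: "x \<in> centre" and y: "y \<in> centre" and "\<And>U. point U \<Longrightarrow> x \<in> U \<longleftrightarrow> y \<in> U" for x y :: 'a
  proof -
    have "x * compl_of y = 0"
      using that by (intro point_separates_zero)
        (auto simp: centre_closed centre_compl point_mult point_compl)
    then show ?thesis using centre_compl(2)[OF y] by (metis add.right_neutral distrib_left mult_1_right)
  qed
  show ?thesis using *[OF a b eq] *[OF b a] eq centre_comm[OF a, of b] by auto
qed

text \<open>Compactness of the Stone space, in the form of an induction principle.\<close>

lemma centre_compact_induct [case_names zero join local]:
  assumes zero: "P 0"
    and join: "\<And>b c. b \<in> centre \<Longrightarrow> c \<in> centre \<Longrightarrow> P b \<Longrightarrow> P c \<Longrightarrow> P (join b c)"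
    and loc: "\<And>U. point U \<Longrightarrow> \<exists>b\<in>U. P b"
  shows "P (1::'r::{semiring_0, monoid_mult})"
proof (rule ccontr)
  assume n: "\<not> P 1"
  \<comment> \<open>The complements of elements satisfying P. This set is multiplicatively closed by
    De Morgan and closure of P under joins, contains 1 by P 0, and omits 0 because P 1 fails; an
    ultrafilter above it contradicts the local hypothesis.\<close>
  let ?F = "{x \<in> centre. P (compl_of x)}"
  obtain U where U: "point U" "?F \<subseteq> U"
  proof (rule ex_point_superset[of ?F])
    show "a * b \<in> ?F" if "a \<in> ?F" "b \<in> ?F" for a b
      using that join[of "compl_of a" "compl_of b"]
      by (simp add: compl_of_mult centre_closed centre_compl)
  qed (use n zero in \<open>auto simp: compl_of_zero_one centre_closed\<close>)
  obtain b where b: "b \<in> U" "P b" using loc U(1) by blast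
  then have "b \<in> centre" using U by (auto simp: point_iff)
  then have "compl_of b \<in> ?F" using b by (simp add: compl_of_compl_of centre_compl)
  then show False using U b point_compl[OF U(1) \<open>b \<in> centre\<close>] by blast
qed

text \<open>Each new summand is orthogonal to the sum of the earlier ones, so by
  \<open>join_orthogonal\<close> the semiring sum is a Boolean join, and ultrafilters are
  prime.\<close>

lemma centre_sum:
  assumes "finite D" and C: "\<And>d. d \<in> D \<Longrightarrow> w d \<in> centre"
    and orth: "\<And>d e. d \<in> D \<Longrightarrow> e \<in> D \<Longrightarrow> d \<noteq> e \<Longrightarrow> w d * w e = 0"
  shows "sum w D \<in> centre \<and> (\<forall>U. point U \<longrightarrow> (sum w D \<in> U \<longleftrightarrow> (\<exists>d\<in>D. w d \<in> U)))"
  using assms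
proof (induction D rule: finite_induct)
  case empty
  then show ?case by (auto simp: centre_closed point_iff)
next
  case (insert a D)
  have "w a * sum w D = 0"
    using insert.hyps insert.prems(2)[of a] by (simp add: sum_distrib_left) (metis sum.neutral)
  then have "sum w (insert a D) = join (w a) (sum w D)"
    using insert.hyps insert.prems(1)[of a] by (simp add: join_orthogonal)
  then show ?case using insert by (auto simp: centre_closed point_join)
qed

lemma centre_prod_list:
  assumes "set xs \<subseteq> centre"
  shows "prod_list xs \<in> centre \<and> (\<forall>U. point U \<longrightarrow> (prod_list xs \<in> U \<longleftrightarrow> set xs \<subseteq> U))"
  using assms by (induction xs) (auto simp: centre_closed point_mult point_iff)

section \<open>Canonical maps into products of quotients\<close>

section \<open>Quotients and products\<close>

lemma congruenceD:
  assumes "congruence \<sigma> ar A \<theta>" "g \<in> \<sigma>" "xs \<in> args (universe A) (ar g)"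
    "ys \<in> args (universe A) (ar g)" "list_all2 (\<lambda>x y. (x, y) \<in> \<theta>) xs ys"
  shows "(opn A g xs, opn A g ys) \<in> \<theta>"
  using assms by (simp add: congruence_def)

text \<open>The quotient operation is a union over all choices of representatives. Compatibility
  makes every choice give the same class, and \<open>xs\<close> is itself a choice, so the union is
  not empty.\<close>

lemma opn_quot_alg:
  assumes \<theta>: "congruence \<sigma> ar A \<theta>" and g: "g \<in> \<sigma>" and xs: "xs \<in> args (universe A) (ar g)"
  shows "opn (quot_alg A \<theta>) g (map (\<lambda>x. \<theta> `` {x}) xs) = \<theta> `` {opn A g xs}"
proof -
  have eq: "equiv (universe A) \<theta>" using \<theta> by (simp add: congruence_def)
  let ?L = "listset (map (\<lambda>x. \<theta> `` {x}) xs)"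
  have L: "ys \<in> ?L \<longleftrightarrow> list_all2 (\<lambda>x y. (x, y) \<in> \<theta>) xs ys" for ys
    by (auto simp: listset_conv_list_all2 list_all2_conv_all_nth)
  have "\<theta> `` {opn A g ys} = \<theta> `` {opn A g xs}" if "ys \<in> ?L" for ys
  proof -
    have xy: "list_all2 (\<lambda>x y. (x, y) \<in> \<theta>) xs ys" using that L by simp
    have "list_all2 (\<lambda>x y. y \<in> universe A) xs ys"
      by (rule list_all2_mono[OF xy]) (use equiv_type[OF eq] in auto)
    then have "ys \<in> args (universe A) (ar g)"
      using xs by (auto simp: args_def list_all2_conv_all_nth in_set_conv_nth)
    then show ?thesis using equiv_class_eq[OF eq congruenceD[OF \<theta> g xs _ xy]] by simp
  qed
  moreover have "xs \<in> ?L"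
    using xs eq unfolding L args_def
    by (auto simp: list_all2_conv_all_nth equiv_def refl_on_def subset_iff)
  ultimately have "(\<Union>ys\<in>?L. \<theta> `` {opn A g ys}) = \<theta> `` {opn A g xs}" by blast
  then show ?thesis by (simp add: quot_alg_def)
qed

text \<open>The canonical map always commutes with the operations, so only bijectivity matters.
  Injectivity says that the congruences intersect trivially, surjectivity that every system of
  congruences is solvable, as in the Chinese remainder theorem.\<close>

lemma alg_iso_prod_quot_iff:
  assumes A: "is_alg \<sigma> ar A" and \<theta>: "\<And>i. i \<in> I \<Longrightarrow> congruence \<sigma> ar A (\<theta> i)"
  shows "alg_iso \<sigma> ar A (prod_alg I (\<lambda>i. quot_alg A (\<theta> i))) (\<lambda>u. \<lambda>i\<in>I. \<theta> i `` {u}) \<longleftrightarrow>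
    (\<forall>u\<in>universe A. \<forall>w\<in>universe A. (\<forall>i\<in>I. (u, w) \<in> \<theta> i) \<longrightarrow> u = w) \<and>
    (\<forall>w. (\<forall>i\<in>I. w i \<in> universe A) \<longrightarrow> (\<exists>u\<in>universe A. \<forall>i\<in>I. (u, w i) \<in> \<theta> i))"
    (is "?iso \<longleftrightarrow> ?inj \<and> ?surj")
proof -
  let ?h = "\<lambda>u. \<lambda>i\<in>I. \<theta> i `` {u}"
  let ?P = "prod_alg I (\<lambda>i. quot_alg A (\<theta> i))"
  have eq: "equiv (universe A) (\<theta> i)" if "i \<in> I" for i
    using \<theta>[OF that] by (simp add: congruence_def)
  have cls: "\<theta> i `` {u} = \<theta> i `` {w} \<longleftrightarrow> (u, w) \<in> \<theta> i"
    if "i \<in> I" "u \<in> universe A" "w \<in> universe A" for i u w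
    using eq_equiv_class_iff[OF eq[OF that(1)]] that by blast
  have heq: "?h u = ?h w \<longleftrightarrow> (\<forall>i\<in>I. (u, w) \<in> \<theta> i)" if "u \<in> universe A" "w \<in> universe A" for u w
    using cls[OF _ that] by (auto simp: fun_eq_iff)
  have U: "universe ?P = (\<Pi>\<^sub>E i\<in>I. universe A // \<theta> i)"
    by (simp add: prod_alg_def quot_alg_def)
  have into: "?h u \<in> universe ?P" if "u \<in> universe A" for u
    using that by (auto simp: U quotientI)
  have repr: "\<exists>w. (\<forall>i\<in>I. w i \<in> universe A) \<and> p = (\<lambda>i\<in>I. \<theta> i `` {w i})" if p: "p \<in> universe ?P" for p
  proof -
    have "\<forall>i\<in>I. \<exists>x\<in>universe A. p i = \<theta> i `` {x}"
      using p unfolding U by (auto simp: quotient_def PiE_def Pi_def)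
    then obtain w where w: "\<forall>i\<in>I. w i \<in> universe A \<and> p i = \<theta> i `` {w i}" by metis
    have "p \<in> extensional I" using p unfolding U by (simp add: PiE_def)
    then have "p = (\<lambda>i\<in>I. \<theta> i `` {w i})"
      using w by (auto simp: fun_eq_iff restrict_def extensional_def)
    then show ?thesis using w by blast
  qed
  have hom: "?h (opn A g xs) = opn ?P g (map ?h xs)"
    if "g \<in> \<sigma>" "xs \<in> args (universe A) (ar g)" for g xs
  proof
    fix i
    show "?h (opn A g xs) i = opn ?P g (map ?h xs) i"
    proof (cases "i \<in> I")
      case True
      then show ?thesis
        using opn_quot_alg[OF \<theta>[OF True] that] by (simp add: prod_alg_def comp_def)
    qed (simp add: prod_alg_def)
  qed
  have bij: "bij_betw ?h (universe A) (universe ?P) \<longleftrightarrow> ?inj \<and> ?surj"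
  proof
    assume b: "bij_betw ?h (universe A) (universe ?P)"
    have ?inj using b heq unfolding bij_betw_def inj_on_def by blast
    moreover have ?surj
    proof (intro allI impI)
      fix w assume w: "\<forall>i\<in>I. w i \<in> universe A"
      then have "(\<lambda>i\<in>I. \<theta> i `` {w i}) \<in> universe ?P" by (auto simp: U quotientI)
      then obtain u where u: "u \<in> universe A" "?h u = (\<lambda>i\<in>I. \<theta> i `` {w i})"
        using b by (metis (no_types, lifting) bij_betw_imp_surj_on imageE)
      have "(u, w i) \<in> \<theta> i" if i: "i \<in> I" for i
        using fun_cong[OF u(2), of i] i cls[OF i u(1)] w by simp
      then show "\<exists>u\<in>universe A. \<forall>i\<in>I. (u, w i) \<in> \<theta> i" using u(1) by blast
    qed
    ultimately show "?inj \<and> ?surj" ..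
  next
    assume inj_surj: "?inj \<and> ?surj"
    have "p \<in> ?h ` universe A" if p: "p \<in> universe ?P" for p
    proof -
      obtain w where w: "\<forall>i\<in>I. w i \<in> universe A" "p = (\<lambda>i\<in>I. \<theta> i `` {w i})"
        using repr[OF p] by blast
      then obtain u where u: "u \<in> universe A" "\<forall>i\<in>I. (u, w i) \<in> \<theta> i" using inj_surj by blast
      have "p = ?h u" unfolding w(2) using cls[OF _ u(1)] u(2) w(1) by (intro restrict_ext) blast
      then show ?thesis using u(1) by blast
    qed
    then have "?h ` universe A = universe ?P" using into by blast
    moreover have "inj_on ?h (universe A)"
      by (rule inj_onI) (use inj_surj heq in blast)
    ultimately show "bij_betw ?h (universe A) (universe ?P)" by (simp add: bij_betw_def)
  qed
  \<comment> \<open>\<open>alg_iso\<close> also requires the target to be an algebra; surjectivity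
    lets its arguments be lifted to \<open>A\<close>.\<close>
  have alg: "is_alg \<sigma> ar ?P" if b: "bij_betw ?h (universe A) (universe ?P)"
    unfolding is_alg_def
  proof (intro conjI ballI)
    show "universe ?P \<noteq> {}" using A into unfolding is_alg_def by blast
    fix g ps assume g: "g \<in> \<sigma>" and ps: "ps \<in> args (universe ?P) (ar g)"
    then have "ps \<in> lists (?h ` universe A)" using b by (simp add: args_def bij_betw_def in_lists_conv_set subset_iff)
    then obtain xs where xs: "xs \<in> lists (universe A)" "ps = map ?h xs"
      unfolding lists_image by blast
    then have args: "xs \<in> args (universe A) (ar g)" using ps by (auto simp: args_def)
    then have "opn A g xs \<in> universe A" using A g by (simp add: is_alg_def)
    then show "opn ?P g ps \<in> universe ?P"
      unfolding xs(2) hom[OF g args, symmetric] by (rule into)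
  qed
  show ?thesis
  proof
    assume ?iso
    then have "bij_betw ?h (universe A) (universe ?P)" by (simp only: alg_iso_def)
    then show "?inj \<and> ?surj" by (simp only: bij)
  next
    assume "?inj \<and> ?surj"
    then have b: "bij_betw ?h (universe A) (universe ?P)" by (simp only: bij)
    show ?iso unfolding alg_iso_def by (intro conjI ballI A alg[OF b] b hom)
  qed
qed

section \<open>Coordinates of vectors and kernels of multiplication\<close>

section \<open>Vectors\<close>

lemma lookup_scale [simp]:
  "Poly_Mapping.lookup (scale r v) d = r * Poly_Mapping.lookup v d"
  by (simp add: scale_def map.rep_eq when_def)

lemma lookup_bvec [simp]: "Poly_Mapping.lookup (bvec e) d = (if e = d then 1 else 0)"
  by (simp add: bvec_def lookup_single when_def)

lemma vecs_iff: "v \<in> vecs E \<longleftrightarrow> (\<forall>d. Poly_Mapping.lookup v d \<noteq> 0 \<longrightarrow> d \<in> E)"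
  by (auto simp: vecs_def in_keys_iff)

lemma zero_in_vecs: "0 \<in> vecs E"
  by (simp add: vecs_iff)

lemma q_op_conv_sum:
  assumes "distinct es"
  shows "q_op es v (map w es) = (\<Sum>e\<in>set es. scale (Poly_Mapping.lookup v e) (w e))"
  unfolding q_op_def sum.distinct_set_conv_list[OF assms] sum_list_sum_nth
  by (simp add: atLeast0LessThan)

lemma prod_list_zero: "0 \<in> set xs \<Longrightarrow> prod_list xs = (0::'r::{semiring_0, monoid_mult})"
  by (induction xs) auto

lemma finite_args: "finite K \<Longrightarrow> finite (args K n)"
  using finite_lists_length_eq[of K n] by (simp add: args_def conj_commute)

text \<open>\<open>vec_op\<close> sums over the supports of its own arguments. Enlarging them to a
  common K adds only tuples with a zero coordinate, and lets different argument lists be compared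
  over one index set.\<close>

lemma lookup_vec_op:
  assumes K: "finite K" "\<And>v. v \<in> set vs \<Longrightarrow> Poly_Mapping.keys v \<subseteq> K"
  shows "Poly_Mapping.lookup (vec_op E g vs) d =
    (\<Sum>ds\<in>args K (length vs). if opn E g ds = d then prod_list (map2 Poly_Mapping.lookup vs ds) else 0)"
proof -
  let ?L = "listset (map Poly_Mapping.keys vs)"
  let ?f = "\<lambda>ds. if opn E g ds = d then prod_list (map2 Poly_Mapping.lookup vs ds) else 0"
  have L: "ds \<in> ?L \<longleftrightarrow> length ds = length vs \<and> (\<forall>i<length vs. ds ! i \<in> Poly_Mapping.keys (vs ! i))" for ds
    by (auto simp: listset_conv_list_all2 list_all2_conv_all_nth)
  have "Poly_Mapping.lookup (vec_op E g vs) d = sum ?f ?L"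
    unfolding vec_op_def lookup_sum by (intro sum.cong) auto
  also have "\<dots> = sum ?f (args K (length vs))"
  proof (rule sum.mono_neutral_left)
    show "finite (args K (length vs))" using K(1) by (rule finite_args)
    show "?L \<subseteq> args K (length vs)"
      using K(2) by (fastforce simp: L args_def in_set_conv_nth)
    show "\<forall>ds\<in>args K (length vs) - ?L. ?f ds = 0"
    proof
      fix ds assume ds: "ds \<in> args K (length vs) - ?L"
      then have len: "length ds = length vs" by (simp add: args_def)
      then obtain i where i: "i < length vs" "Poly_Mapping.lookup (vs ! i) (ds ! i) = 0"
        using ds by (auto simp: L in_keys_iff)
      then have "0 \<in> set (map2 Poly_Mapping.lookup vs ds)"
        using len unfolding set_conv_nth by (auto intro!: exI[of _ i])
      then show "?f ds = 0" by (simp add: prod_list_zero)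
    qed
  qed
  finally show ?thesis .
qed

text \<open>Since r commutes with everything, it can be moved next to each factor in turn, and the
  factors are replaced one at a time.\<close>

lemma commuting_mult_cong:
  assumes r: "commuting r" and "r * a = r * a'" and "r * b = r * b'"
  shows "r * (a * b) = r * (a' * b')"
proof -
  have c: "r * x = x * r" for x using r by (simp add: commuting_def)
  have "r * (a * b) = r * a' * b" using assms(2) by (simp flip: mult.assoc)
  also have "\<dots> = a' * (r * b)" by (simp add: c[of a'] mult.assoc)
  also have "\<dots> = a' * r * b'" using assms(3) by (simp add: mult.assoc)
  also have "\<dots> = r * (a' * b')" by (simp add: mult.assoc flip: c[of a'])
  finally show ?thesis .
qed

lemma commuting_prod_list_cong:
  assumes r: "commuting r" and "list_all2 (\<lambda>a b. r * a = r * b) xs ys"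
  shows "r * prod_list xs = r * prod_list ys"
  using assms(2) by induction (auto intro: commuting_mult_cong[OF r])

text \<open>The kernel of multiplication by r; with r a coordinate of v it later bounds \<theta>(v,
  e) from above. Products of coordinates respect it by \<open>commuting_mult_cong\<close>, sums by
  distributivity.\<close>

lemma congruence_mult_kernel:
  fixes E :: "('f, 'e) alg" and r :: "'r::{semiring_0, monoid_mult}"
  assumes E: "is_alg \<tau> ar E" and r: "commuting r"
  shows "congruence (vsyms \<tau> (universe E)) (varity ar) (vec_alg E)
    {(u, w). u \<in> vecs (universe E) \<and> w \<in> vecs (universe E) \<and>
       (\<forall>d. r * Poly_Mapping.lookup u d = r * Poly_Mapping.lookup w d)}"
    (is "congruence ?S ?ar ?V ?T")
  unfolding congruence_def
proof (intro conjI ballI impI)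
  show "equiv (universe ?V) ?T"
    by (rule equivI) (auto simp: vec_alg_def refl_on_def sym_def trans_def)
  fix s xs ys
  assume s: "s \<in> ?S" and xs: "xs \<in> args (universe ?V) (?ar s)"
    and ys: "ys \<in> args (universe ?V) (?ar s)" and xy: "list_all2 (\<lambda>x y. (x, y) \<in> ?T) xs ys"
  have len: "length xs = ?ar s" "length ys = ?ar s" using xs ys by (auto simp: args_def)
  have nth: "r * Poly_Mapping.lookup (xs ! i) d = r * Poly_Mapping.lookup (ys ! i) d"
    if "i < ?ar s" for i d
    using xy that len by (auto simp: list_all2_conv_all_nth)
  have "r * Poly_Mapping.lookup (vopn E s xs) d = r * Poly_Mapping.lookup (vopn E s ys) d" for d
  proof (cases s)
    case VAdd
    then show ?thesis using nth[of 0] nth[of 1] by (simp add: lookup_add distrib_left)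
  next
    case (VScale a)
    then show ?thesis using commuting_mult_cong[OF r refl nth[of 0]] by simp
  next
    case (VOp g)
    define K where "K = (\<Union>v\<in>set xs \<union> set ys. Poly_Mapping.keys v)"
    have fin: "finite K" by (simp add: K_def)
    have lk: "Poly_Mapping.lookup (vec_op E g zs) d =
        (\<Sum>ds\<in>args K (ar g). if opn E g ds = d then prod_list (map2 Poly_Mapping.lookup zs ds) else 0)"
      if "zs = xs \<or> zs = ys" for zs
    proof -
      have "Poly_Mapping.keys v \<subseteq> K" if "v \<in> set zs" for v
        using that \<open>zs = xs \<or> zs = ys\<close> by (auto simp: K_def)
      then show ?thesis using lookup_vec_op[OF fin, of zs E g d] that len VOp by auto
    qed
    have "r * prod_list (map2 Poly_Mapping.lookup xs ds) = r * prod_list (map2 Poly_Mapping.lookup ys ds)"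
      if "ds \<in> args K (ar g)" for ds
      by (rule commuting_prod_list_cong[OF r])
        (use that len nth VOp in \<open>auto simp: list_all2_conv_all_nth args_def\<close>)
    then show ?thesis
      unfolding VOp vopn.simps lk[OF disjI1[OF refl]] lk[OF disjI2[OF refl]] sum_distrib_left
      by (intro sum.cong) auto
  next
    case (VQ es)
    obtain x xs' y ys' where c: "xs = x # xs'" "ys = y # ys'"
      using len VQ by (cases xs; cases ys) auto
    show ?thesis
      unfolding VQ c vopn.simps list.sel q_op_def lookup_sum sum_distrib_left lookup_scale
      by (intro sum.cong refl commuting_mult_cong[OF r])
        (use nth[of 0] nth[of "Suc _"] VQ c in auto)
  qed simp_all
  moreover have "vopn E s zs \<in> vecs (universe E)" if "zs \<in> args (universe ?V) (?ar s)" for zs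
    using is_alg_vec_alg[OF E, where 'r='r] that s by (simp add: is_alg_def vec_alg_def)
  ultimately show "(opn ?V s xs, opn ?V s ys) \<in> ?T"
    using xs ys by (simp add: vec_alg_def)
qed

section \<open>Finite centrality as a partition of unity\<close>

section \<open>Finitely central vectors\<close>

text \<open>A partition of unity seen through ultrafilters, so that operations on vectors can be
  computed one ultrafilter at a time; \<open>selector_iff_partition\<close> gives the algebraic
  form.\<close>

definition selector :: "('e \<Rightarrow>\<^sub>0 'r::{semiring_0, monoid_mult}) \<Rightarrow> bool" where
  "selector v \<longleftrightarrow> (\<forall>d. Poly_Mapping.lookup v d \<in> centre) \<and>
     (\<forall>U. point U \<longrightarrow> (\<exists>!d. Poly_Mapping.lookup v d \<in> U))"

definition select :: "('e \<Rightarrow>\<^sub>0 'r::{semiring_0, monoid_mult}) \<Rightarrow> 'r set \<Rightarrow> 'e" where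
  "select v U = (THE d. Poly_Mapping.lookup v d \<in> U)"

lemma selectorI:
  assumes "\<And>d. Poly_Mapping.lookup v d \<in> centre"
    and "\<And>U d. point U \<Longrightarrow> Poly_Mapping.lookup v d \<in> U \<longleftrightarrow> d = f U"
  shows "selector v"
  using assms unfolding selector_def by metis

lemma selector_centre: "selector v \<Longrightarrow> Poly_Mapping.lookup v d \<in> centre"
  by (simp add: selector_def)

lemma selector_mem_iff:
  assumes "selector v" "point U"
  shows "Poly_Mapping.lookup v d \<in> U \<longleftrightarrow> d = select v U"
proof -
  have ex1: "\<exists>!d. Poly_Mapping.lookup v d \<in> U" using assms by (simp add: selector_def)
  show ?thesis unfolding select_def using theI'[OF ex1] ex1 by blast
qed

lemma select_eq:
  assumes "point U" "\<And>d. Poly_Mapping.lookup v d \<in> U \<longleftrightarrow> d = e"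
  shows "select v U = e"
  using assms by (simp add: select_def)

lemma select_in_keys:
  assumes "selector v" "point U" shows "select v U \<in> Poly_Mapping.keys v"
  using selector_mem_iff[OF assms, of "select v U"] assms(2) by (auto simp: in_keys_iff point_iff)

text \<open>Forwards, orthogonality and the sum are tested in each ultrafilter. Backwards, 1 lies in
  every ultrafilter, so primeness puts some coordinate there, and orthogonality forbids two because
  0 lies in none.\<close>

lemma selector_iff_partition:
  assumes "finite I" "Poly_Mapping.keys v \<subseteq> I"
  shows "selector v \<longleftrightarrow> (\<forall>d. Poly_Mapping.lookup v d \<in> centre) \<and>
    (\<forall>d e. d \<noteq> e \<longrightarrow> Poly_Mapping.lookup v d * Poly_Mapping.lookup v e = 0) \<and>
    (\<Sum>d\<in>I. Poly_Mapping.lookup v d) = 1"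
    (is "_ \<longleftrightarrow> ?C \<and> ?O \<and> ?S")
proof
  assume sel: "selector v"
  have C: "Poly_Mapping.lookup v d \<in> centre" for d using sel by (rule selector_centre)
  have O: "Poly_Mapping.lookup v d * Poly_Mapping.lookup v e = 0" if "d \<noteq> e" for d e
    using that C
    by (intro point_separates_zero) (auto simp: centre_closed point_mult selector_mem_iff[OF sel])
  have sum: "(\<Sum>d\<in>I. Poly_Mapping.lookup v d) \<in> centre"
    "\<And>U. point U \<Longrightarrow> (\<Sum>d\<in>I. Poly_Mapping.lookup v d) \<in> U \<longleftrightarrow> (\<exists>d\<in>I. Poly_Mapping.lookup v d \<in> U)"
    using centre_sum[OF assms(1), of "Poly_Mapping.lookup v"] C O by auto
  have "(\<Sum>d\<in>I. Poly_Mapping.lookup v d) = 1"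
  proof (rule centre_eqI[OF sum(1) centre_closed(2)])
    fix U :: "'b set" assume U: "point U"
    have "select v U \<in> I" using select_in_keys[OF sel U] assms(2) by blast
    then show "(\<Sum>d\<in>I. Poly_Mapping.lookup v d) \<in> U \<longleftrightarrow> 1 \<in> U"
      using U sum(2)[OF U] selector_mem_iff[OF sel U] by (auto simp: point_iff)
  qed
  then show "?C \<and> ?O \<and> ?S" using C O by blast
next
  assume *: "?C \<and> ?O \<and> ?S"
  have "\<exists>!d. Poly_Mapping.lookup v d \<in> U" if U: "point U" for U
  proof -
    have "(\<Sum>d\<in>I. Poly_Mapping.lookup v d) \<in> U \<longleftrightarrow> (\<exists>d\<in>I. Poly_Mapping.lookup v d \<in> U)"
      using centre_sum[OF assms(1), of "Poly_Mapping.lookup v"] * U by simp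
    then have "\<exists>d\<in>I. Poly_Mapping.lookup v d \<in> U" using U * by (simp add: point_iff)
    moreover have "d = e" if "Poly_Mapping.lookup v d \<in> U" "Poly_Mapping.lookup v e \<in> U" for d e
      using that * U unfolding point_iff by metis
    ultimately show ?thesis by blast
  qed
  then show "selector v" using * by (simp add: selector_def)
qed

text \<open>Only the first argument of the operation \<open>VQ es\<close> is changed, from v to the
  basis vector of e, so the value stays in its class; at that basis vector the sum collapses to
  \<open>w e\<close>.\<close>

lemma congruence_vec_alg_q:
  assumes E: "is_alg \<tau> ar E" and \<theta>: "congruence (vsyms \<tau> (universe E)) (varity ar) (vec_alg E) \<theta>"
    and v: "v \<in> vecs (universe E)" "(v, bvec e) \<in> \<theta>"
    and I: "finite I" "I \<subseteq> universe E" "e \<in> I"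
    and w: "\<And>i. i \<in> I \<Longrightarrow> w i \<in> vecs (universe E)"
  shows "((\<Sum>i\<in>I. scale (Poly_Mapping.lookup v i) (w i)), w e) \<in> \<theta>"
proof -
  obtain es where es: "set es = I" "distinct es" using finite_distinct_list[OF I(1)] by blast
  have eq: "equiv (vecs (universe E)) \<theta>" using \<theta> by (simp add: congruence_def vec_alg_def)
  have "(opn (vec_alg E) (VQ es) (v # map w es), opn (vec_alg E) (VQ es) (bvec e # map w es)) \<in> \<theta>"
  proof (rule congruenceD[OF \<theta>])
    show "VQ es \<in> vsyms \<tau> (universe E)" using es I by (auto simp: vsyms_def)
    show "v # map w es \<in> args (universe (vec_alg E)) (varity ar (VQ es))"
      "bvec e # map w es \<in> args (universe (vec_alg E)) (varity ar (VQ es))"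
      using v w es I by (auto simp: args_def vec_alg_def intro: vecs_bvec)
    show "list_all2 (\<lambda>x y. (x, y) \<in> \<theta>) (v # map w es) (bvec e # map w es)"
      using v w es eq by (auto simp: equiv_def refl_on_def list.rel_map intro!: list.rel_refl_strong)
  qed
  moreover have "(\<Sum>i\<in>I. scale (Poly_Mapping.lookup (bvec e) i) (w i)) = w e"
  proof -
    have "(\<Sum>i\<in>I. scale (Poly_Mapping.lookup (bvec e) i) (w i)) = (\<Sum>i\<in>I. if i = e then w i else 0)"
      by (intro sum.cong refl poly_mapping_eqI) auto
    then show ?thesis using I by simp
  qed
  ultimately show ?thesis using es by (simp add: vec_alg_def q_op_conv_sum)
qed

context
  fixes \<tau> :: "'f set" and ar :: "'f \<Rightarrow> nat" and E :: "('f, 'e) alg"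
    and v :: "'e \<Rightarrow>\<^sub>0 'r::{semiring_0, monoid_mult}"
  assumes E: "is_alg \<tau> ar E" and v: "v \<in> vecs (universe E)"
begin

lemma vtheta:
  assumes "e \<in> universe E"
  shows "congruence (vsyms \<tau> (universe E)) (varity ar) (vec_alg E) (vtheta \<tau> ar E v (bvec e))"
    and "(v, bvec e) \<in> vtheta \<tau> ar E v (bvec e)"
  unfolding vtheta_def
  by (intro congruence_princ_cong[OF is_alg_vec_alg[OF E]]; use v assms in \<open>simp add: vec_alg_def vecs_bvec\<close>)+

lemma I_central_iff:
  assumes "I \<subseteq> universe E"
  shows "I_central \<tau> ar E I v \<longleftrightarrow>
    (\<forall>u\<in>vecs (universe E). \<forall>w\<in>vecs (universe E).
       (\<forall>e\<in>I. (u, w) \<in> vtheta \<tau> ar E v (bvec e)) \<longrightarrow> u = w) \<and>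
    (\<forall>w. (\<forall>e\<in>I. w e \<in> vecs (universe E)) \<longrightarrow>
       (\<exists>u\<in>vecs (universe E). \<forall>e\<in>I. (u, w e) \<in> vtheta \<tau> ar E v (bvec e)))"
  unfolding I_central_def
  using alg_iso_prod_quot_iff[OF is_alg_vec_alg[OF E], of I "\<lambda>e. vtheta \<tau> ar E v (bvec e)"]
    vtheta(1) assms by (simp add: subset_iff) (simp add: vec_alg_def)

text \<open>Every equation about the coordinates of v is obtained from \<open>uniq\<close> by
  exhibiting a second solution of the system solved by \<open>Q w\<close> and comparing
  coordinates.\<close>

lemma I_central_imp_selector:
  assumes I: "finite I" "I \<noteq> {}" "I \<subseteq> universe E" and cen: "I_central \<tau> ar E I v"
  shows "selector v"
proof -
  let ?V = "vecs (universe E) :: ('e \<Rightarrow>\<^sub>0 'r) set"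
  let ?\<theta> = "\<lambda>e. vtheta \<tau> ar E v (bvec e)"
  define Q where "Q w = (\<Sum>i\<in>I. scale (Poly_Mapping.lookup v i) (w i))" for w :: "'e \<Rightarrow> 'e \<Rightarrow>\<^sub>0 'r"
  have QV: "Q w \<in> ?V" if "\<And>i. i \<in> I \<Longrightarrow> w i \<in> ?V" for w
    unfolding Q_def by (intro vecs_sum vecs_scale that)
  have Q: "(Q w, w e) \<in> ?\<theta> e" if "e \<in> I" "\<And>i. i \<in> I \<Longrightarrow> w i \<in> ?V" for w e
    unfolding Q_def using that I vtheta[of e] v by (intro congruence_vec_alg_q[OF E]) auto
  have eq: "equiv ?V (?\<theta> e)" if "e \<in> I" for e
    using vtheta(1)[of e] that I by (auto simp: congruence_def vec_alg_def)
  have inj: "\<forall>u\<in>?V. \<forall>w\<in>?V. (\<forall>e\<in>I. (u, w) \<in> ?\<theta> e) \<longrightarrow> u = w"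
    using cen unfolding I_central_iff[OF I(3)] by (rule conjunct1)
  have uniq: "u = Q w" if u: "u \<in> ?V" and w: "\<And>i. i \<in> I \<Longrightarrow> w i \<in> ?V"
    and uw: "\<And>e. e \<in> I \<Longrightarrow> (u, w e) \<in> ?\<theta> e" for u w
  proof -
    have "(u, Q w) \<in> ?\<theta> e" if "e \<in> I" for e
      using uw[OF that] Q[OF that w] eq[OF that] unfolding equiv_def by (meson symD transD)
    then show ?thesis using inj u QV[OF w] by simp
  qed
  obtain e0 where e0: "e0 \<in> I" using I by blast
  have b: "bvec e \<in> ?V" if "e \<in> I" for e using that I by (auto intro: vecs_bvec)
  \<comment> \<open>Families concentrated at one index isolate one coordinate of v:
    \<open>Q (\<delta> i u)\<close> is u scaled by the coordinate of v at i.\<close>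
  define \<delta> where "\<delta> i u = (\<lambda>e. if e = i then u else 0)" for i :: 'e and u :: "'e \<Rightarrow>\<^sub>0 'r"
  have \<delta>V: "\<delta> i u e \<in> ?V" if "u \<in> ?V" for i u e using that by (simp add: \<delta>_def zero_in_vecs)
  have Q\<delta>: "Poly_Mapping.lookup (Q (\<delta> i u)) d = Poly_Mapping.lookup v i * Poly_Mapping.lookup u d"
    if "i \<in> I" for i u d
  proof -
    have "Poly_Mapping.lookup (Q (\<delta> i u)) d =
        (\<Sum>e\<in>I. if e = i then Poly_Mapping.lookup v i * Poly_Mapping.lookup u d else 0)"
      unfolding Q_def lookup_sum by (intro sum.cong) (auto simp: \<delta>_def)
    then show ?thesis using that I by simp
  qed
  \<comment> \<open>By definition of \<theta>(v, e), v itself solves the system with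
    \<open>w = bvec\<close>; hence v equals \<open>Q bvec\<close>, which is supported in I.\<close>
  have keys: "Poly_Mapping.keys v \<subseteq> I"
  proof -
    have "v = Q bvec"
      by (rule uniq[OF v b]) (use vtheta(2) I in auto)
    then have "Poly_Mapping.lookup v d = Poly_Mapping.lookup (Q bvec) d" for d by simp
    also have "Poly_Mapping.lookup (Q bvec) d = (\<Sum>e\<in>I. if e = d then Poly_Mapping.lookup v e else 0)" for d
      unfolding Q_def lookup_sum by (intro sum.cong) auto
    finally have "Poly_Mapping.lookup v d = (if d \<in> I then Poly_Mapping.lookup v d else 0)" for d
      using I by simp
    then show ?thesis by (metis in_keys_iff subsetI)
  qed
  \<comment> \<open>A constant family is solved by its constant value.\<close>
  have sum: "(\<Sum>i\<in>I. Poly_Mapping.lookup v i) = 1"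
  proof -
    have "bvec e0 = Q (\<lambda>_. bvec e0)"
      by (rule uniq) (use b e0 eq in \<open>auto simp: equiv_def refl_on_def\<close>)
    then have "Poly_Mapping.lookup (bvec e0) e0 = Poly_Mapping.lookup (Q (\<lambda>_. bvec e0)) e0" by simp
    then show ?thesis by (simp add: Q_def lookup_sum)
  qed
  \<comment> \<open>Scaling the solution for \<open>\<delta> i (bvec e0)\<close> by r solves the
    scaled family. At e0 one side carries r on the left of the coordinate of v, the other on its
    right.\<close>
  have comm: "r * Poly_Mapping.lookup v i = Poly_Mapping.lookup v i * r" if i: "i \<in> I" for i r
  proof -
    have "scale r (Q (\<delta> i (bvec e0))) = Q (\<delta> i (scale r (bvec e0)))"
    proof (rule uniq)
      fix e assume e: "e \<in> I"
      have "(opn (vec_alg E) (VScale r) [Q (\<delta> i (bvec e0))],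
          opn (vec_alg E) (VScale r) [\<delta> i (bvec e0) e]) \<in> ?\<theta> e"
      proof (rule congruenceD[OF vtheta(1)])
        show "list_all2 (\<lambda>x y. (x, y) \<in> ?\<theta> e) [Q (\<delta> i (bvec e0))] [\<delta> i (bvec e0) e]"
          using Q[OF e \<delta>V[OF b[OF e0]]] by simp
      qed (use e I QV[OF \<delta>V] \<delta>V b[OF e0] in \<open>auto simp: vsyms_def args_def vec_alg_def\<close>)
      moreover have "scale r (\<delta> i (bvec e0) e) = \<delta> i (scale r (bvec e0)) e"
        by (rule poly_mapping_eqI) (simp add: \<delta>_def)
      ultimately show "(scale r (Q (\<delta> i (bvec e0))), \<delta> i (scale r (bvec e0)) e) \<in> ?\<theta> e"
        by (simp add: vec_alg_def)
    qed (use b[OF e0] in \<open>auto intro!: vecs_scale QV \<delta>V\<close>)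
    then have "Poly_Mapping.lookup (scale r (Q (\<delta> i (bvec e0)))) e0 =
        Poly_Mapping.lookup (Q (\<delta> i (scale r (bvec e0)))) e0" by simp
    then show ?thesis by (simp add: Q\<delta>[OF i])
  qed
  \<comment> \<open>Zero solves the family whose entry at i is
    \<open>Q (\<delta> j (bvec e0))\<close>: modulo \<open>?\<theta> i\<close> that entry is
    congruent to \<open>\<delta> j (bvec e0) i\<close>, which is 0 as i differs from j.\<close>
  have orth: "Poly_Mapping.lookup v i * Poly_Mapping.lookup v j = 0"
    if i: "i \<in> I" and j: "j \<in> I" and ij: "i \<noteq> j" for i j
  proof -
    have "0 = Q (\<delta> i (Q (\<delta> j (bvec e0))))"
    proof (rule uniq)
      fix e assume e: "e \<in> I"
      have "(Q (\<delta> j (bvec e0)), \<delta> j (bvec e0) i) \<in> ?\<theta> i"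
        by (rule Q[OF i \<delta>V[OF b[OF e0]]])
      then have "(0, Q (\<delta> j (bvec e0))) \<in> ?\<theta> i"
        using eq[OF i] ij by (auto simp: \<delta>_def equiv_def sym_def)
      moreover have "(0, 0) \<in> ?\<theta> e" using eq[OF e] by (auto simp: equiv_def refl_on_def zero_in_vecs)
      ultimately show "(0, \<delta> i (Q (\<delta> j (bvec e0))) e) \<in> ?\<theta> e" by (simp add: \<delta>_def)
    qed (use b[OF e0] in \<open>auto intro!: QV \<delta>V zero_in_vecs\<close>)
    then have "Poly_Mapping.lookup 0 e0 = Poly_Mapping.lookup (Q (\<delta> i (Q (\<delta> j (bvec e0))))) e0" by simp
    then show ?thesis by (simp add: Q\<delta>[OF i] Q\<delta>[OF j])
  qed
  have out: "Poly_Mapping.lookup v d = 0" if "d \<notin> I" for d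
    using that keys by (auto simp: in_keys_iff)
  have "Poly_Mapping.lookup v d \<in> centre" for d
  proof (cases "d \<in> I")
    case True
    \<comment> \<open>The complement of a coordinate is the sum of all the others.\<close>
    let ?c = "\<Sum>i\<in>I - {d}. Poly_Mapping.lookup v i"
    have "Poly_Mapping.lookup v d + ?c = 1" using sum sum.remove[OF I(1) True] by metis
    moreover have "Poly_Mapping.lookup v d * ?c = 0"
      unfolding sum_distrib_left by (rule sum.neutral) (use orth True in auto)
    ultimately show ?thesis
      using comm[OF True] unfolding centre_def complemented_def commuting_def by auto
  qed (simp add: out centre_closed)
  moreover have "Poly_Mapping.lookup v d * Poly_Mapping.lookup v e = 0" if "d \<noteq> e" for d e
    using that orth[of d e] out[of d] out[of e] by (cases "d \<in> I"; cases "e \<in> I") auto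
  ultimately show ?thesis using sum by (simp add: selector_iff_partition[OF I(1) keys])
qed

text \<open>Solvability is witnessed by q_I(v, w). For uniqueness, congruent vectors agree after
  multiplication by each coordinate of v, and summing over I recovers the vectors.\<close>

lemma selector_imp_I_central:
  assumes sel: "selector v" and I: "finite I" "Poly_Mapping.keys v \<subseteq> I" "I \<subseteq> universe E"
  shows "I_central \<tau> ar E I v"
proof -
  let ?V = "vecs (universe E) :: ('e \<Rightarrow>\<^sub>0 'r) set"
  let ?\<theta> = "\<lambda>e. vtheta \<tau> ar E v (bvec e)"
  have C: "Poly_Mapping.lookup v d \<in> centre"
    and orth: "d \<noteq> e \<Longrightarrow> Poly_Mapping.lookup v d * Poly_Mapping.lookup v e = 0"
    and sum: "(\<Sum>d\<in>I. Poly_Mapping.lookup v d) = 1" for d e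
    using sel selector_iff_partition[OF I(1,2)] by auto
  have \<theta>D: "Poly_Mapping.lookup v e * Poly_Mapping.lookup u d = Poly_Mapping.lookup v e * Poly_Mapping.lookup w d"
    if "(u, w) \<in> ?\<theta> e" and e: "e \<in> I" for u w e d
  proof -
    let ?T = "{(u, w). u \<in> ?V \<and> w \<in> ?V \<and> (\<forall>d. Poly_Mapping.lookup v e * Poly_Mapping.lookup u d
      = Poly_Mapping.lookup v e * Poly_Mapping.lookup w d)}"
    \<comment> \<open>The generating pair lies in the kernel: orthogonality handles d different from
      e, idempotence the case d = e.\<close>
    have "Poly_Mapping.lookup v e * Poly_Mapping.lookup v d =
        Poly_Mapping.lookup v e * Poly_Mapping.lookup (bvec e) d" for d
      using orth[of e d] centre_idem[OF C] by simp
    then have "(v, bvec e) \<in> ?T" using v e I by (auto intro: vecs_bvec)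
    moreover have "congruence (vsyms \<tau> (universe E)) (varity ar) (vec_alg E) ?T"
      by (rule congruence_mult_kernel[OF E]) (use C in \<open>simp add: centre_def\<close>)
    ultimately have "?\<theta> e \<subseteq> ?T" unfolding vtheta_def by (intro princ_cong_least)
    then show ?thesis using that by blast
  qed
  have "u = w" if uw: "\<And>e. e \<in> I \<Longrightarrow> (u, w) \<in> ?\<theta> e" for u w
  proof (rule poly_mapping_eqI)
    fix d
    have "Poly_Mapping.lookup u d = (\<Sum>e\<in>I. Poly_Mapping.lookup v e * Poly_Mapping.lookup u d)"
      using sum by (simp flip: sum_distrib_right)
    also have "\<dots> = (\<Sum>e\<in>I. Poly_Mapping.lookup v e * Poly_Mapping.lookup w d)"
      using \<theta>D[OF uw] by simp
    also have "\<dots> = Poly_Mapping.lookup w d" using sum by (simp flip: sum_distrib_right)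
    finally show "Poly_Mapping.lookup u d = Poly_Mapping.lookup w d" .
  qed
  moreover have "\<exists>u\<in>?V. \<forall>e\<in>I. (u, w e) \<in> ?\<theta> e" if w: "\<forall>e\<in>I. w e \<in> ?V" for w
  proof
    show "(\<Sum>i\<in>I. scale (Poly_Mapping.lookup v i) (w i)) \<in> ?V"
      using w by (intro vecs_sum vecs_scale) auto
    show "\<forall>e\<in>I. (\<Sum>i\<in>I. scale (Poly_Mapping.lookup v i) (w i), w e) \<in> ?\<theta> e"
    proof
      fix e assume e: "e \<in> I"
      show "(\<Sum>i\<in>I. scale (Poly_Mapping.lookup v i) (w i), w e) \<in> ?\<theta> e"
        by (rule congruence_vec_alg_q[OF E]) (use e I v w vtheta[of e] in auto)
    qed
  qed
  ultimately show ?thesis unfolding I_central_iff[OF I(3)] by blast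
qed

lemma finitely_central_iff_selector: "finitely_central \<tau> ar E v \<longleftrightarrow> selector v"
proof
  assume "selector v"
  moreover obtain e0 where "e0 \<in> universe E" using E by (auto simp: is_alg_def)
  ultimately show "finitely_central \<tau> ar E v"
    unfolding finitely_central_def using v
    \<comment> \<open>Adding \<open>e0\<close> keeps the index set nonempty: over the trivial
      semiring v = 0 is a selector with empty support.\<close>
    by (intro exI[of _ "insert e0 (Poly_Mapping.keys v)"])
      (auto simp: vecs_def intro!: selector_imp_I_central)
qed (auto simp: finitely_central_def intro: I_central_imp_selector)

end

section \<open>Ultrafilterwise computation of the operations\<close>

section \<open>Operations on selectors\<close>

text \<open>In a given ultrafilter exactly one product \<open>P ds\<close> lies, that of the tuple
  of selected indices. Each coordinate of the result is an orthogonal sum of such products, hence a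
  join, so it lies in the ultrafilter iff its index is the value of g at that tuple.\<close>

lemma selector_vec_op:
  fixes vs :: "('e \<Rightarrow>\<^sub>0 'r::{semiring_0, monoid_mult}) list"
  assumes sel: "\<And>v. v \<in> set vs \<Longrightarrow> selector v"
  shows "selector (vec_op E g vs)"
    and "point U \<Longrightarrow> select (vec_op E g vs) U = opn E g (map (\<lambda>v. select v U) vs)"
proof -
  define K where "K = (\<Union>v\<in>set vs. Poly_Mapping.keys v)"
  have K: "finite K" "\<And>v. v \<in> set vs \<Longrightarrow> Poly_Mapping.keys v \<subseteq> K" by (auto simp: K_def)
  let ?A = "args K (length vs)"
  define P where "P ds = prod_list (map2 Poly_Mapping.lookup vs ds)" for ds
  have finA: "finite ?A" using K(1) by (rule finite_args)
  have C: "set (map2 Poly_Mapping.lookup vs ds) \<subseteq> centre" for ds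
    using sel by (auto dest!: set_zip_leftD simp: selector_centre)
  have PC: "P ds \<in> centre" for ds using centre_prod_list[OF C] by (simp add: P_def)
  have PU: "P ds \<in> U \<longleftrightarrow> ds = map (\<lambda>v. select v U) vs" if U: "point U" and ds: "ds \<in> ?A" for U ds
  proof -
    have len: "length ds = length vs" using ds by (simp add: args_def)
    have "P ds \<in> U \<longleftrightarrow> set (map2 Poly_Mapping.lookup vs ds) \<subseteq> U"
      using centre_prod_list[OF C] U by (simp add: P_def)
    also have "\<dots> \<longleftrightarrow> (\<forall>i<length vs. Poly_Mapping.lookup (vs ! i) (ds ! i) \<in> U)"
      using len by (auto simp: set_zip)
    also have "\<dots> \<longleftrightarrow> (\<forall>i<length vs. ds ! i = select (vs ! i) U)"
      using selector_mem_iff[OF sel U] by simp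
    also have "\<dots> \<longleftrightarrow> ds = map (\<lambda>v. select v U) vs"
      using len by (auto simp: list_eq_iff_nth_eq)
    finally show ?thesis .
  qed
  have orth: "P ds * P es = 0" if "ds \<in> ?A" "es \<in> ?A" "ds \<noteq> es" for ds es
    using that PC by (intro point_separates_zero) (auto simp: centre_closed point_mult PU)
  have lk: "Poly_Mapping.lookup (vec_op E g vs) d = sum P {ds \<in> ?A. opn E g ds = d}" for d
    using lookup_vec_op[of K vs E g d] K unfolding sum.inter_filter[OF finA] P_def by simp
  have sum: "sum P {ds \<in> ?A. opn E g ds = d} \<in> centre \<and> (\<forall>U. point U \<longrightarrow>
      (sum P {ds \<in> ?A. opn E g ds = d} \<in> U \<longleftrightarrow> (\<exists>ds\<in>{ds \<in> ?A. opn E g ds = d}. P ds \<in> U)))" for d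
    by (rule centre_sum) (use finA PC orth in auto)
  have mem: "Poly_Mapping.lookup (vec_op E g vs) d \<in> U \<longleftrightarrow> d = opn E g (map (\<lambda>v. select v U) vs)"
    if U: "point U" for U d
  proof -
    have "map (\<lambda>v. select v U) vs \<in> ?A"
      using select_in_keys[OF sel U] K(2) by (fastforce simp: args_def)
    then show ?thesis using sum[of d] U PU[OF U] unfolding lk by auto
  qed
  show "selector (vec_op E g vs)"
    by (rule selectorI[OF _ mem]) (use sum in \<open>auto simp: lk\<close>)
  show "select (vec_op E g vs) U = opn E g (map (\<lambda>v. select v U) vs)" if "point U"
    using select_eq[OF that mem[OF that]] .
qed

lemma selector_eqI:
  assumes v: "selector v" and w: "selector w" and eq: "\<And>U. point U \<Longrightarrow> select v U = select w U"
  shows "v = w"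
  by (intro poly_mapping_eqI centre_eqI selector_centre v w)
    (simp add: selector_mem_iff[OF v] selector_mem_iff[OF w] eq)

section \<open>Locally constant maps and the vectors representing them\<close>

section \<open>Continuous maps on the Stone space\<close>

lemma topspace_stone_centre: "topspace (stone_space centre_balg) = {U. point U}"
  by (rule topspace_stone_space[OF is_boolalg_centre])

lemma openin_stone_centre_basic:
  assumes "b \<in> centre" shows "openin (stone_space centre_balg) {U. point U \<and> b \<in> U}"
  unfolding stone_space_def openin_topology_generated_by_iff
  by (rule generate_topology_on.Basis) (use assms in \<open>auto simp: centre_balg_def centre_def\<close>)

text \<open>The generating sets form a base, since the sets of b and c intersect in the set of
  \<open>b * c\<close>.\<close>

lemma openin_stone_centre_nbhd:
  assumes "openin (stone_space centre_balg) W" "U \<in> W"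
  shows "\<exists>b\<in>U. \<forall>U'. point U' \<and> b \<in> U' \<longrightarrow> U' \<in> W"
  using assms unfolding stone_space_def openin_topology_generated_by_iff
proof (induction arbitrary: U)
  case (Int W1 W2)
  obtain b where b: "b \<in> U" "\<forall>U'. point U' \<and> b \<in> U' \<longrightarrow> U' \<in> W1"
    using Int.IH(1)[of U] Int.prems by blast
  obtain c where c: "c \<in> U" "\<forall>U'. point U' \<and> c \<in> U' \<longrightarrow> U' \<in> W2"
    using Int.IH(2)[of U] Int.prems by blast
  \<comment> \<open>The induction does not say that members of W1 are ultrafilters; this is
    recovered from the topological space and gives \<open>point U\<close>.\<close>
  have "generate_topology_on ((\<lambda>b. {U. point U \<and> b \<in> U}) ` bcarrier centre_balg) W1" by fact
  then have "W1 \<subseteq> {U. point U}"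
    using openin_subset[of "stone_space centre_balg" W1] topspace_stone_centre
    by (auto simp: stone_space_def openin_topology_generated_by_iff)
  then have U: "point U" using Int.prems by blast
  then have C: "b \<in> centre" "c \<in> centre" using b c by (auto simp: point_iff)
  then have "b * c \<in> U" using U b c by (simp add: point_mult)
  moreover have "U' \<in> W1 \<inter> W2" if "point U'" "b * c \<in> U'" for U'
    using that b(2) c(2) point_mult[OF that(1) C] by blast
  ultimately show ?case by blast
qed blast+

text \<open>The preimage of S is the union, over d in S, of the basic open sets of the coordinates
  of v.\<close>

lemma continuous_map_select:
  assumes v: "v \<in> vecs E" and sel: "selector v"
  shows "continuous_map (stone_space centre_balg) (discrete_topology E) (\<lambda>U\<in>{U. point U}. select v U)"
  unfolding continuous_map_def topspace_stone_centre topspace_discrete_topology openin_discrete_topology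
proof (intro conjI allI impI)
  show "(\<lambda>U\<in>{U. point U}. select v U) \<in> {U. point U} \<rightarrow> E"
    using select_in_keys[OF sel] v by (auto simp: vecs_def)
  fix S
  have "openin (stone_space centre_balg) (\<Union>d\<in>S. {U. point U \<and> Poly_Mapping.lookup v d \<in> U})"
    by (intro openin_Union) (use openin_stone_centre_basic selector_centre[OF sel] in blast)
  moreover have "{U \<in> {U. point U}. (\<lambda>U\<in>{U. point U}. select v U) U \<in> S} =
      (\<Union>d\<in>S. {U. point U \<and> Poly_Mapping.lookup v d \<in> U})"
    using selector_mem_iff[OF sel] by auto
  ultimately show "openin (stone_space centre_balg)
      {U \<in> {U. point U}. (\<lambda>U\<in>{U. point U}. select v U) U \<in> S}" by simp
qed

text \<open>f is locally constant, and compactness is used twice: f has finitely many values, and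
  each fibre of f is the basic set of a central element. These elements are the coordinates of
  v.\<close>

lemma continuous_map_stone_obtain_selector:
  fixes f :: "'r::{semiring_0, monoid_mult} set \<Rightarrow> 'e"
  assumes f: "continuous_map (stone_space centre_balg) (discrete_topology E) f"
  obtains v where "v \<in> vecs E" "selector v" "\<And>U. point U \<Longrightarrow> select v U = f U"
proof -
  have fE: "f U \<in> E" if "point U" for U
    using f that topspace_stone_centre[where 'a='r] unfolding continuous_map_def by auto
  have loc: "\<exists>b\<in>U. \<forall>U'. point U' \<and> b \<in> U' \<longrightarrow> f U' = f U" if U: "point U" for U
  proof -
    have "openin (stone_space centre_balg) {U' \<in> topspace (stone_space centre_balg). f U' \<in> {f U}}"
      using f fE[OF U] unfolding continuous_map_def openin_discrete_topology by blast
    from openin_stone_centre_nbhd[OF this, of U] show ?thesis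
      using U by (simp add: topspace_stone_centre)
  qed
  have "finite (f ` {U. point U \<and> (1::'r) \<in> U})"
  proof (induction rule: centre_compact_induct)
    case zero
    have "{U. point U \<and> (0::'r) \<in> U} = {}" by (auto simp: point_iff)
    then show ?case by (simp only: image_empty finite.emptyI)
  next
    case (join b c)
    then have "{U. point U \<and> join b c \<in> U} = {U. point U \<and> b \<in> U} \<union> {U. point U \<and> c \<in> U}"
      by (auto simp: point_join)
    then show ?case using join by (simp only: image_Un finite_UnI)
  next
    case (local U)
    then obtain b where "b \<in> U" "\<forall>U'. point U' \<and> b \<in> U' \<longrightarrow> f U' = f U" using loc by blast
    moreover from this have "f ` {U'. point U' \<and> b \<in> U'} \<subseteq> {f U}" by blast
    ultimately show ?case using finite_subset by blast
  qed
  moreover have one: "point U \<and> (1::'r) \<in> U \<longleftrightarrow> point U" for U by (auto simp: point_iff)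
  ultimately have fin: "finite (f ` {U. point U})" by simp
  \<comment> \<open>Induction on the element in place of 1: within its basic set, the fibre over d
    is cut out by some central c.\<close>
  have "\<exists>c\<in>centre. \<forall>U. point U \<and> (1::'r) \<in> U \<longrightarrow> (c \<in> U \<longleftrightarrow> f U = d)" for d
  proof (induction rule: centre_compact_induct)
    case zero
    show ?case using centre_closed(1) by (auto simp: point_iff)
  next
    case (join b b2)
    then obtain c c2 where c: "c \<in> centre" "\<forall>U. point U \<and> b \<in> U \<longrightarrow> (c \<in> U \<longleftrightarrow> f U = d)"
      and c2: "c2 \<in> centre" "\<forall>U. point U \<and> b2 \<in> U \<longrightarrow> (c2 \<in> U \<longleftrightarrow> f U = d)" by blast
    \<comment> \<open>Gluing: c is used on the basic set of b, and c2 off it.\<close>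
    let ?c = "join (b * c) (compl_of b * c2)"
    have "?c \<in> centre" using join c c2 by (intro centre_closed centre_compl)
    moreover have "?c \<in> U \<longleftrightarrow> f U = d" if U: "point U" "join b b2 \<in> U" for U
    proof -
      have "?c \<in> U \<longleftrightarrow> b \<in> U \<and> c \<in> U \<or> b \<notin> U \<and> c2 \<in> U"
        using join c c2 U(1) by (simp add: point_join point_mult point_compl centre_closed centre_compl)
      moreover have "b \<in> U \<or> b2 \<in> U" using U join by (simp add: point_join)
      ultimately show ?thesis using c(2) c2(2) U(1) by blast
    qed
    ultimately show ?case by blast
  next
    case (local U)
    then obtain b e where b: "b \<in> U" "\<forall>U'. point U' \<and> b \<in> U' \<longrightarrow> f U' = e" using loc by blast
    have "\<exists>c\<in>centre. \<forall>U'. point U' \<and> b \<in> U' \<longrightarrow> (c \<in> U' \<longleftrightarrow> f U' = d)"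
    proof (cases "e = d")
      case True
      then have "1 \<in> U' \<longleftrightarrow> f U' = d" if "point U'" "b \<in> U'" for U'
        using b(2) that by (auto simp: point_iff)
      then show ?thesis using centre_closed(2) by blast
    next
      case False
      then have "0 \<in> U' \<longleftrightarrow> f U' = d" if "point U'" "b \<in> U'" for U'
        using b(2) that by (auto simp: point_iff)
      then show ?thesis using centre_closed(1) by blast
    qed
    then show ?case using b(1) by blast
  qed
  then have "\<exists>c\<in>centre. \<forall>U::'r set. point U \<longrightarrow> (c \<in> U \<longleftrightarrow> f U = d)" for d
    using one by simp
  then obtain c where c: "\<And>d. c d \<in> centre" "\<And>U d. point U \<Longrightarrow> c d \<in> U \<longleftrightarrow> f U = d"
    by metis
  \<comment> \<open>A nonzero \<open>c d\<close> lies in some ultrafilter, so d is a value of f;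
    this gives the finite support required by \<open>Abs_poly_mapping\<close>.\<close>
  have sub: "{d. c d \<noteq> 0} \<subseteq> f ` {U. point U}"
  proof
    fix d assume "d \<in> {d. c d \<noteq> 0}"
    then obtain U where "point U" "c d \<in> U" using point_separates_zero[OF c(1), of d] by auto
    then show "d \<in> f ` {U. point U}" using c(2) by auto
  qed
  then have "finite {d. c d \<noteq> 0}" using fin by (rule finite_subset)
  then have lk: "Poly_Mapping.lookup (Abs_poly_mapping c) = c" by (rule Abs_poly_mapping_inverse[OF CollectI])
  show thesis
  proof (rule that[of "Abs_poly_mapping c"])
    show "Abs_poly_mapping c \<in> vecs E" using sub fE by (auto simp: vecs_iff lk)
    show "selector (Abs_poly_mapping c)" by (rule selectorI[of _ f]) (auto simp: lk c)
    show "select (Abs_poly_mapping c) U = f U" if "point U" for U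
      by (rule select_eq[OF that]) (auto simp: lk c(2)[OF that])
  qed
qed

section \<open>The isomorphism onto the Boolean power\<close>

theorem theorem5p8:
  fixes \<tau> :: "'f set" and ar :: "'f \<Rightarrow> nat" and E :: "('f, 'e) alg"
  assumes "is_alg \<tau> ar E"
  shows "isomorphic \<tau> ar
    (semiring_power \<tau> ar E :: ('f, 'e \<Rightarrow>\<^sub>0 'r::{semiring_0, monoid_mult}) alg)
    (boolean_power (centre_balg :: 'r boolalg) E)"
proof -
  let ?A = "semiring_power \<tau> ar E :: ('f, 'e \<Rightarrow>\<^sub>0 'r) alg"
  let ?B = "boolean_power (centre_balg :: 'r boolalg) E"
  let ?X = "{U :: 'r set. point U}"
  let ?h = "\<lambda>v :: 'e \<Rightarrow>\<^sub>0 'r. \<lambda>U\<in>?X. select v U"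
  note E = assms
  have UA: "universe ?A = {v \<in> vecs (universe E). selector v}"
    using finitely_central_iff_selector[OF E] by (auto simp: semiring_power_def)
  have UB: "universe ?B = {f \<in> extensional ?X.
      continuous_map (stone_space centre_balg) (discrete_topology (universe E)) f}"
    by (simp add: boolean_power_def cont_alg_def topspace_stone_centre)
  have into: "?h v \<in> universe ?B" if "v \<in> universe ?A" for v
    using that continuous_map_select by (auto simp: UA UB)
  have opA: "opn ?A g vs \<in> universe ?A" if g: "g \<in> \<tau>" and vs: "vs \<in> args (universe ?A) (ar g)" for g vs
  proof -
    have "VOp g \<in> vsyms \<tau> (universe E)" using g by (simp add: vsyms_def)
    moreover have "vs \<in> args (universe (vec_alg E)) (varity ar (VOp g))"
      using vs by (auto simp: args_def UA vec_alg_def)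
    ultimately have "opn (vec_alg E) (VOp g) vs \<in> universe (vec_alg E)"
      using is_alg_vec_alg[OF E, where 'r='r] unfolding is_alg_def by blast
    moreover have "selector (vec_op E g vs)"
      using vs by (intro selector_vec_op) (auto simp: args_def UA)
    ultimately show ?thesis unfolding UA by (simp add: semiring_power_def vec_alg_def)
  qed
  have hom: "?h (opn ?A g vs) = opn ?B g (map ?h vs)"
    if "g \<in> \<tau>" "vs \<in> args (universe ?A) (ar g)" for g vs
  proof -
    have sel: "selector v" if "v \<in> set vs" for v
      using that \<open>vs \<in> _\<close> by (auto simp: args_def UA)
    have "select (vec_op E g vs) U = opn E g (map (\<lambda>f. f U) (map ?h vs))" if "point U" for U
      using selector_vec_op(2)[OF sel that] that by (simp add: comp_def)
    then show ?thesis
      by (auto simp: semiring_power_def boolean_power_def cont_alg_def topspace_stone_centre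
          intro!: restrict_ext)
  qed
  have inj: "inj_on ?h (universe ?A)"
  proof (rule inj_onI)
    fix v w assume vw: "v \<in> universe ?A" "w \<in> universe ?A" "?h v = ?h w"
    show "v = w"
    proof (rule selector_eqI)
      show "select v U = select w U" if "point U" for U
        using fun_cong[OF vw(3), of U] that by simp
    qed (use vw in \<open>auto simp: UA\<close>)
  qed
  have surj: "f \<in> ?h ` universe ?A" if f: "f \<in> universe ?B" for f
  proof -
    obtain v where v: "v \<in> vecs (universe E)" "selector v" "\<And>U. point U \<Longrightarrow> select v U = f U"
      using f continuous_map_stone_obtain_selector[of "universe E" f] unfolding UB by blast
    have "f = ?h v" using f v(3) by (auto simp: UB fun_eq_iff extensional_def)
    then show ?thesis using v by (auto simp: UA)
  qed
  have img: "?h ` universe ?A = universe ?B" using into surj by blast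
  have neA: "universe ?A \<noteq> {}"
  proof -
    obtain e where e: "e \<in> universe E" using E by (auto simp: is_alg_def)
    \<comment> \<open>A basis vector corresponds to a constant map.\<close>
    have "selector (bvec e :: 'e \<Rightarrow>\<^sub>0 'r)"
      by (rule selectorI[of _ "\<lambda>_. e"]) (auto simp: centre_closed point_iff)
    then have "bvec e \<in> universe ?A" using e by (simp add: UA vecs_bvec)
    then show ?thesis by blast
  qed
  have algA: "is_alg \<tau> ar ?A" using neA opA by (simp add: is_alg_def)
  \<comment> \<open>Closure of the continuous maps under the operations is transported from the
    semiring power along the surjection \<open>?h\<close>.\<close>
  have algB: "is_alg \<tau> ar ?B"
    unfolding is_alg_def
  proof (intro conjI ballI)
    show "universe ?B \<noteq> {}" using neA img by blast
    fix g fs assume g: "g \<in> \<tau>" and fs: "fs \<in> args (universe ?B) (ar g)"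
    then have "fs \<in> lists (?h ` universe ?A)" unfolding img by (auto simp: args_def)
    then obtain vs where vs: "vs \<in> lists (universe ?A)" "fs = map ?h vs"
      unfolding lists_image by blast
    then have args: "vs \<in> args (universe ?A) (ar g)" using fs by (auto simp: args_def)
    show "opn ?B g fs \<in> universe ?B"
      unfolding vs(2) hom[OF g args, symmetric] by (intro into opA g args)
  qed
  have "bij_betw ?h (universe ?A) (universe ?B)" using inj img by (simp add: bij_betw_def)
  then have "alg_iso \<tau> ar ?A ?B ?h" unfolding alg_iso_def using algA algB hom by blast
  then show ?thesis unfolding isomorphic_def by blast
qed

end
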